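(* Let $0<\alpha<1$, $h>0$, and $a=(\Gamma(2-\alpha)h^\alpha)^{-1}$. Let $f\in L^2(\Omega)$ and let $u\in H^1(\Omega)$ be the weak solution of $$(aI-\Delta)u=af$$ with periodic boundary conditions. Then: 1. $u$ is the unique minimizer over $H^1(\Omega)$ of $$J_f(v)=\frac12\int_\Omega|\nabla v|^2\,dx+\frac a2\int_\Omega|v-f|^2\,dx .$$ 2. The resolvent preserves the spatial average: $\int_\Omega u\,dx=\int_\Omega f\,dx$. 3. $\|u\|_{L^2(\Omega)}\le\|f\|_{L^2(\Omega)}$. More generally, if $f_1,f_2\in L^2(\Omega)$ and $u_1,u_2\in H^1(\Omega)$ satisfy $(aI-\Delta)u_i=af_i$ for $i=1,2$, then $\|u_1-u_2\|_{L^2(\Omega)}\le\|f_1-f_2\|_{L^2(\Omega)}$. 4. If $0\le f\le1$ a.e., then $0\le u\le1$ a.e. If $f_1\le f_2$ a.e., then the corresponding solutions satisfy $u_1\le u_2$ a.e.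
   Context: $\Omega=[0,\Lambda)^d\cong\mathbb{T}^d$ is the flat torus with periodic boundary conditions and Lebesgue measure; functions here are real-valued, and $H^1(\Omega)$ is the periodic Sobolev space. $\Gamma$ is the Gamma function. Equations of the form $(aI-\Delta)u=af$ are understood in the weak sense with periodic boundary conditions. *)

theory Defs
  imports "HOL-Analysis.Analysis"
begin

text \<open>
  The torus is modelled by its fundamental cell in \<open>real ^ 'n\<close>, so the dimension is
  \<open>CARD('n)\<close>. Functions on the torus are ordinary functions of which only the values on the cell
  matter, and elements of \<open>L\<^sup>2\<close> are compared up to null sets of the cell. Periodicity
  enters through the test functions that define the weak gradient.
\<close>

definition cell :: "real \<Rightarrow> (real ^ 'n) set" where
  "cell L = {x. \<forall>i. 0 \<le> x $ i \<and> x $ i < L}"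

abbreviation torus :: "real \<Rightarrow> (real ^ 'n) measure" where
  "torus L \<equiv> lebesgue_on (cell L)"

definition L2 :: "real \<Rightarrow> (real ^ 'n \<Rightarrow> real) set" where
  "L2 L = {f. f \<in> borel_measurable (torus L) \<and> integrable (torus L) (\<lambda>x. (f x)\<^sup>2)}"

definition norm_L2 :: "real \<Rightarrow> (real ^ 'n \<Rightarrow> real) \<Rightarrow> real" where
  "norm_L2 L f = sqrt (\<integral>x. (f x)\<^sup>2 \<partial>torus L)"

definition partial_deriv :: "'n \<Rightarrow> (real ^ 'n \<Rightarrow> real) \<Rightarrow> real ^ 'n \<Rightarrow> real" where
  "partial_deriv i \<phi> x = frechet_derivative \<phi> (at x) (axis i 1)"

fun C_k :: "nat \<Rightarrow> (real ^ 'n \<Rightarrow> real) \<Rightarrow> bool" where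
  "C_k 0 \<phi> \<longleftrightarrow> continuous_on UNIV \<phi>"
| "C_k (Suc k) \<phi> \<longleftrightarrow> (\<forall>x. \<phi> differentiable (at x)) \<and> (\<forall>i. C_k k (partial_deriv i \<phi>))"

definition test_functions :: "real \<Rightarrow> (real ^ 'n \<Rightarrow> real) set" where
  "test_functions L = {\<phi>. (\<forall>k. C_k k \<phi>) \<and> (\<forall>i x. \<phi> (x + L *\<^sub>R axis i 1) = \<phi> x)}"

definition has_weak_grad ::
  "real \<Rightarrow> (real ^ 'n \<Rightarrow> real) \<Rightarrow> (real ^ 'n \<Rightarrow> real ^ 'n) \<Rightarrow> bool" where
  "has_weak_grad L u G \<longleftrightarrow>
     (\<forall>i. (\<lambda>x. G x $ i) \<in> L2 L \<and>
          (\<forall>\<phi>\<in>test_functions L.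
             (\<integral>x. u x * partial_deriv i \<phi> x \<partial>torus L) = - (\<integral>x. G x $ i * \<phi> x \<partial>torus L)))"

definition H1 :: "real \<Rightarrow> (real ^ 'n \<Rightarrow> real) set" where
  "H1 L = {u \<in> L2 L. \<exists>G. has_weak_grad L u G}"

text \<open>
  The weak gradient is determined only up to a null set, and \<open>weak_grad\<close> picks a
  representative. It is meaningful only on \<open>H1 L\<close>.
\<close>

definition weak_grad :: "real \<Rightarrow> (real ^ 'n \<Rightarrow> real) \<Rightarrow> real ^ 'n \<Rightarrow> real ^ 'n" where
  "weak_grad L u = (SOME G. has_weak_grad L u G)"

text \<open>Weak form of \<open>(a I - \<Delta>) u = a f\<close>, tested against all of \<open>H1 L\<close>.\<close>

definition weak_solution ::
  "real \<Rightarrow> real \<Rightarrow> (real ^ 'n \<Rightarrow> real) \<Rightarrow> (real ^ 'n \<Rightarrow> real) \<Rightarrow> bool" where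
  "weak_solution L a f u \<longleftrightarrow>
     u \<in> H1 L \<and>
     (\<forall>v\<in>H1 L. a * (\<integral>x. u x * v x \<partial>torus L)
                + (\<integral>x. weak_grad L u x \<bullet> weak_grad L v x \<partial>torus L)
              = a * (\<integral>x. f x * v x \<partial>torus L))"

definition J_functional ::
  "real \<Rightarrow> real \<Rightarrow> (real ^ 'n \<Rightarrow> real) \<Rightarrow> (real ^ 'n \<Rightarrow> real) \<Rightarrow> real" where
  "J_functional L a f v =
     1/2 * (\<integral>x. (norm (weak_grad L v x))\<^sup>2 \<partial>torus L)
     + a/2 * (\<integral>x. \<bar>v x - f x\<bar>\<^sup>2 \<partial>torus L)"

definition is_minimizer_H1 ::
  "real \<Rightarrow> ((real ^ 'n \<Rightarrow> real) \<Rightarrow> real) \<Rightarrow> (real ^ 'n \<Rightarrow> real) \<Rightarrow> bool" where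
  "is_minimizer_H1 L J u \<longleftrightarrow> u \<in> H1 L \<and> (\<forall>v\<in>H1 L. J u \<le> J v)"

end

theory Submission
  imports Defs
begin

text \<open>
  The energy statements follow by testing the weak equation with the functions at hand. The weak
  gradient is unique because trigonometric polynomials are dense, by Stone--Weierstrass on the
  product of circles.

  For the comparison principle no chain rule for truncations in \<open>H1\<close> is needed. Each
  trigonometric polynomial \<open>p\<close> is \<open>(I - \<Delta> / a) w\<close> for another one \<open>w\<close>, and
  \<open>w \<ge> 0\<close> if \<open>p \<ge> 0\<close> by looking at a minimum of \<open>w\<close>. Testing with \<open>w\<close> gives
  \<open>\<integral> u p = \<integral> f w\<close>, so \<open>f \<ge> 0\<close> makes the integral of \<open>u\<close> against every non-negative
  trigonometric polynomial non-negative, and by density \<open>u \<ge> 0\<close>.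
\<close>

subsection \<open>The cell and square-integrable functions on it\<close>

text \<open>\<open>weak_grad\<close> is a bare choice of representative, and this shapes the
  argument. Before the weak equation can be tested usefully with a trigonometric polynomial, the
  chosen gradient must be matched with the classical one: this takes uniqueness of weak gradients
  and also integration by parts on the cell, which makes the classical gradient a weak one. The
  energy arguments never use a difference of two Sobolev functions as a test function: the equations
  are tested with each function separately and the resulting integrals are combined. The obstacle in
  the density step is that periodic functions cannot separate opposite faces of the closed cube.
  Hence the approximation takes place on the image in the product of circles, and only for functions
  vanishing off the open cube, which suffices because the rest of the cell is null.\<close>

lemma cell_borel [measurable]: "(cell L :: (real ^ 'n) set) \<in> sets borel"
proof -
  have "cell L = (\<Inter>i. {x :: real ^ 'n. 0 \<le> x $ i} \<inter> {x. x $ i < L})"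
    by (auto simp: cell_def)
  also have "\<dots> \<in> sets borel"
    by (intro sets.countable_INT'' sets.Int borel_closed borel_open
        closed_halfspace_component_ge_cart open_halfspace_component_lt_cart) auto
  finally show ?thesis .
qed

lemma cell_subset_cbox: "cell L \<subseteq> cbox (0 :: real ^ 'n) (\<chi> i. L)"
  by (auto simp: cell_def mem_box_cart less_imp_le)

lemma cell_lebesgue [simp]: "(cell L :: (real ^ 'n) set) \<in> sets lebesgue"
  using cell_borel by simp

lemma cell_lmeasurable: "(cell L :: (real ^ 'n) set) \<in> lmeasurable"
proof (rule bounded_set_imp_lmeasurable)
  show "bounded (cell L :: (real ^ 'n) set)"
    by (rule bounded_subset[OF bounded_cbox cell_subset_cbox])
qed simp

lemma finite_measure_torus: "finite_measure (torus L :: (real ^ 'n) measure)"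
  by (intro finite_measure_lebesgue_on cell_lmeasurable)

lemma integrable_L2_mult:
  fixes f g :: "real ^ 'n \<Rightarrow> real"
  assumes "f \<in> L2 L" "g \<in> L2 L"
  shows "integrable (torus L) (\<lambda>x. f x * g x)"
proof (rule Bochner_Integration.integrable_bound)
  show "integrable (torus L) (\<lambda>x. (f x)\<^sup>2 + (g x)\<^sup>2)"
    using assms by (auto simp: L2_def)
  have "\<bar>s * t\<bar> \<le> s\<^sup>2 + t\<^sup>2" for s t :: real
    using sum_squares_bound[of "\<bar>s\<bar>" "\<bar>t\<bar>"] abs_ge_zero[of "s * t"]
    unfolding abs_mult power2_abs by linarith
  then show "AE x in torus L. norm (f x * g x) \<le> norm ((f x)\<^sup>2 + (g x)\<^sup>2)"
    by simp
qed (use assms in \<open>auto simp: L2_def\<close>)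

lemma L2_bounded:
  fixes f :: "real ^ 'n \<Rightarrow> real"
  assumes "f \<in> borel_measurable (torus L)" "\<And>x. x \<in> cell L \<Longrightarrow> \<bar>f x\<bar> \<le> B"
  shows "f \<in> L2 L"
proof -
  interpret finite_measure "torus L :: (real ^ 'n) measure"
    by (rule finite_measure_torus)
  have "AE x in torus L. norm ((f x)\<^sup>2) \<le> B\<^sup>2"
  proof (intro AE_I2)
    fix x assume "x \<in> space (torus L :: (real ^ 'n) measure)"
    then have "\<bar>f x\<bar> \<le> B"
      using assms(2) by simp
    then show "norm ((f x)\<^sup>2) \<le> B\<^sup>2"
      using power_mono[of "\<bar>f x\<bar>" B 2] by simp
  qed
  then have "integrable (torus L) (\<lambda>x. (f x)\<^sup>2)"
    using assms(1) by (intro integrable_const_bound) auto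
  then show ?thesis
    using assms(1) by (simp add: L2_def)
qed

lemma L2_continuous:
  fixes f :: "real ^ 'n \<Rightarrow> real"
  assumes "continuous_on UNIV f"
  shows "f \<in> L2 L"
proof -
  have "compact (f ` cbox 0 (\<chi> i. L))"
    using assms by (intro compact_continuous_image) (auto intro: continuous_on_subset)
  then obtain B where "\<forall>y \<in> f ` cbox 0 (\<chi> i. L). norm y \<le> B"
    using compact_imp_bounded bounded_iff by metis
  then have "\<bar>f x\<bar> \<le> B" if "x \<in> cell L" for x
    using that cell_subset_cbox[where 'n='n, of L] by auto
  moreover have "f \<in> borel_measurable (torus L)"
    using assms
    by (intro continuous_imp_measurable_on_sets_lebesgue) (auto intro: continuous_on_subset)
  ultimately show ?thesis
    by (rule L2_bounded[rotated])
qed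

lemma integrable_L2:
  fixes f :: "real ^ 'n \<Rightarrow> real"
  assumes "f \<in> L2 L"
  shows "integrable (torus L) f"
  using integrable_L2_mult[OF assms L2_continuous, of "\<lambda>_. 1"] by simp

lemma L2_diff:
  fixes f g :: "real ^ 'n \<Rightarrow> real"
  assumes "f \<in> L2 L" "g \<in> L2 L"
  shows "(\<lambda>x. f x - g x) \<in> L2 L"
proof -
  have "integrable (torus L) (\<lambda>x. (f x)\<^sup>2 + (g x)\<^sup>2 - 2 * (f x * g x))"
    using assms integrable_L2_mult[OF assms] unfolding L2_def by auto
  also have "(\<lambda>x. (f x)\<^sup>2 + (g x)\<^sup>2 - 2 * (f x * g x)) = (\<lambda>x. (f x - g x)\<^sup>2)"
    by (simp add: power2_diff fun_eq_iff)
  finally show ?thesis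
    using assms by (auto simp: L2_def)
qed

subsection \<open>Trigonometric polynomials\<close>

text \<open>Frequencies lie in the dual lattice of the periods, which makes every mode periodic. The
  phase \<open>b\<close> absorbs sines, so that differentiation, a phase shift by
  \<open>pi / 2\<close> up to a factor, maps a mode to a mode and a single base case
  suffices.\<close>

inductive trig_poly :: "real \<Rightarrow> (real ^ 'n \<Rightarrow> real) \<Rightarrow> bool" for L where
  mode: "(\<And>i. \<exists>m::int. k $ i = 2 * pi * m / L) \<Longrightarrow> trig_poly L (\<lambda>x. c * cos (k \<bullet> x + b))"
| add: "trig_poly L p \<Longrightarrow> trig_poly L q \<Longrightarrow> trig_poly L (\<lambda>x. p x + q x)"

lemma trig_poly_const: "trig_poly L (\<lambda>_ :: real ^ 'n. c)"
  using trig_poly.mode[of 0 L c 0] by (auto intro: exI[of _ "0::int"])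

text \<open>By the product-to-sum formula two modes multiply to two modes with frequencies
  \<open>k - k'\<close> and \<open>k + k'\<close>. Closure under products gives the algebra that
  Stone--Weierstrass asks for.\<close>

lemma trig_poly_mult:
  assumes "trig_poly L p" "trig_poly L q"
  shows "trig_poly L (\<lambda>x. p x * q x)"
  using assms
proof (induction rule: trig_poly.induct)
  case (mode k c b)
  note k = mode(1)
  from mode(2) show ?case
  proof (induction rule: trig_poly.induct)
    case (mode k' c' b')
    have "\<exists>m::int. (k + k') $ i = 2 * pi * m / L" for i
    proof -
      obtain m m' :: int where "k $ i = 2 * pi * m / L" "k' $ i = 2 * pi * m' / L"
        using k mode by blast
      then show ?thesis
        by (intro exI[of _ "m + m'"]) (simp add: algebra_simps add_divide_distrib)
    qed
    moreover have "\<exists>m::int. (k - k') $ i = 2 * pi * m / L" for i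
    proof -
      obtain m m' :: int where "k $ i = 2 * pi * m / L" "k' $ i = 2 * pi * m' / L"
        using k mode by blast
      then show ?thesis
        by (intro exI[of _ "m - m'"]) (simp add: algebra_simps diff_divide_distrib)
    qed
    ultimately have "trig_poly L (\<lambda>x. (c * c' / 2) * cos ((k - k') \<bullet> x + (b - b'))
        + (c * c' / 2) * cos ((k + k') \<bullet> x + (b + b')))"
      by (intro trig_poly.intros)
    moreover have "(c * c' / 2) * cos ((k - k') \<bullet> x + (b - b'))
        + (c * c' / 2) * cos ((k + k') \<bullet> x + (b + b'))
        = (c * cos (k \<bullet> x + b)) * (c' * cos (k' \<bullet> x + b'))" for x
    proof -
      have "(k - k') \<bullet> x + (b - b') = (k \<bullet> x + b) - (k' \<bullet> x + b')"
        "(k + k') \<bullet> x + (b + b') = (k \<bullet> x + b) + (k' \<bullet> x + b')"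
        by (simp_all add: inner_add_left inner_diff_left)
      then show ?thesis
        by (simp only: cos_add[of "k \<bullet> x + b"] cos_diff[of "k \<bullet> x + b"]) (simp add: field_simps)
    qed
    ultimately show ?case
      by simp
  next
    case (add p q)
    then show ?case
      using trig_poly.add[OF add.IH] by (simp add: algebra_simps)
  qed
next
  case (add p1 p2)
  show ?case
    using trig_poly.add[OF add.IH(1)[OF add.prems] add.IH(2)[OF add.prems]] by (simp add: algebra_simps)
qed

lemma trig_poly_differentiable:
  "trig_poly L p \<Longrightarrow> p differentiable (at x)"
proof (induction rule: trig_poly.induct)
  case (mode k c b)
  have "((\<lambda>x. c * cos (k \<bullet> x + b)) has_derivative
      (\<lambda>y. c * (- sin (k \<bullet> x + b) * (k \<bullet> y)))) (at x)"
    by (auto intro!: derivative_eq_intros)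
  then show ?case
    by (rule differentiableI)
qed (auto intro: differentiable_add)

lemma trig_poly_continuous: "trig_poly L p \<Longrightarrow> continuous_on S p"
  by (intro continuous_at_imp_continuous_on ballI differentiable_imp_continuous_within)
     (rule trig_poly_differentiable)

lemma partial_deriv_add:
  assumes "p differentiable (at x)" "q differentiable (at x)"
  shows "partial_deriv i (\<lambda>x. p x + q x) x = partial_deriv i p x + partial_deriv i q x"
proof -
  have "((\<lambda>x. p x + q x) has_derivative
      (\<lambda>y. frechet_derivative p (at x) y + frechet_derivative q (at x) y)) (at x)"
    by (intro has_derivative_add assms[unfolded frechet_derivative_works])
  then show ?thesis
    by (simp add: partial_deriv_def flip: frechet_derivative_at)
qed

lemma partial_deriv_mult:
  fixes p q :: "real ^ 'n \<Rightarrow> real"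
  assumes "p differentiable (at x)" "q differentiable (at x)"
  shows "partial_deriv i (\<lambda>x. p x * q x) x = p x * partial_deriv i q x + partial_deriv i p x * q x"
proof -
  have "((\<lambda>x. p x * q x) has_derivative
      (\<lambda>y. p x * frechet_derivative q (at x) y + frechet_derivative p (at x) y * q x)) (at x)"
    by (intro has_derivative_mult assms[unfolded frechet_derivative_works])
  then show ?thesis
    by (simp add: partial_deriv_def flip: frechet_derivative_at)
qed

lemma partial_deriv_mode:
  "partial_deriv i (\<lambda>x. c * cos (k \<bullet> x + b)) = (\<lambda>x. (c * k $ i) * cos (k \<bullet> x + (b + pi / 2)))"
proof
  fix x
  have "((\<lambda>x. c * cos (k \<bullet> x + b)) has_derivative
      (\<lambda>y. c * (- sin (k \<bullet> x + b) * (k \<bullet> y)))) (at x)"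
    by (auto intro!: derivative_eq_intros)
  then have "partial_deriv i (\<lambda>x. c * cos (k \<bullet> x + b)) x = c * (- sin (k \<bullet> x + b) * (k \<bullet> axis i 1))"
    by (simp add: partial_deriv_def flip: frechet_derivative_at)
  then show "partial_deriv i (\<lambda>x. c * cos (k \<bullet> x + b)) x
      = (c * k $ i) * cos (k \<bullet> x + (b + pi / 2))"
    by (simp add: inner_axis cos_add add.assoc[symmetric])
qed

lemma trig_poly_partial_deriv: "trig_poly L p \<Longrightarrow> trig_poly L (partial_deriv i p)"
proof (induction rule: trig_poly.induct)
  case (mode k c b)
  then show ?case
    by (simp add: partial_deriv_mode trig_poly.mode)
next
  case (add p q)
  have "partial_deriv i (\<lambda>x. p x + q x) = (\<lambda>x. partial_deriv i p x + partial_deriv i q x)"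
    using add by (intro ext partial_deriv_add trig_poly_differentiable)
  then show ?case
    using trig_poly.add[OF add.IH] by simp
qed

lemma trig_poly_periodic:
  assumes "0 < L" "trig_poly L p" "\<And>i. \<exists>m::int. z $ i = L * m"
  shows "p (x + z) = p x"
  using assms(2)
proof (induction rule: trig_poly.induct)
  case (mode k c b)
  have "\<exists>m::int. k $ i * z $ i = 2 * pi * m" for i
  proof -
    obtain m m' :: int where "k $ i = 2 * pi * m / L" "z $ i = L * m'"
      using mode assms(3) by blast
    then show ?thesis
      using \<open>0 < L\<close> by (intro exI[of _ "m * m'"]) simp
  qed
  then obtain m :: "'a \<Rightarrow> int" where "\<And>i. k $ i * z $ i = 2 * pi * m i"
    by metis
  then have "k \<bullet> z = 2 * pi * (\<Sum>i\<in>UNIV. m i)"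
    by (simp add: inner_vec_def sum_distrib_left)
  then have "k \<bullet> (x + z) + b = (k \<bullet> x + b) + 2 * pi * (\<Sum>i\<in>UNIV. m i)"
    by (simp add: inner_add_right)
  then have "cos (k \<bullet> (x + z) + b) = cos (k \<bullet> x + b)"
    using sin_cos_eq_iff by blast
  then show ?case by simp
qed auto

text \<open>A single \<open>y\<close> serves all \<open>p\<close> at once. It carries bounds known
  on the cell over to the whole space, where positivity and minima are stated.\<close>

lemma trig_poly_cell_representative:
  fixes x :: "real ^ 'n"
  assumes "0 < L"
  obtains y where "y \<in> cell L" "\<And>p. trig_poly L p \<Longrightarrow> p y = p x"
proof
  define z :: "real ^ 'n" where "z = (\<chi> i. L * of_int (- \<lfloor>x $ i / L\<rfloor>))"
  show "x + z \<in> cell L"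
  proof -
    have "0 \<le> x $ i + z $ i \<and> x $ i + z $ i < L" for i
    proof -
      show ?thesis
        using floor_divide_lower[OF assms, of "x $ i"] floor_divide_upper[OF assms, of "x $ i"]
        by (simp add: z_def algebra_simps)
    qed
    then show ?thesis by (simp add: cell_def)
  qed
  show "p (x + z) = p x" if "trig_poly L p" for p
    using assms that by (rule trig_poly_periodic) (auto simp: z_def intro: exI[of _ "- \<lfloor>x $ i / L\<rfloor>" for i])
qed

lemma trig_poly_C_k: "trig_poly L p \<Longrightarrow> C_k k p"
proof (induction k arbitrary: p)
  case (Suc k)
  then show ?case
    using trig_poly_differentiable[OF Suc.prems] trig_poly_partial_deriv[OF Suc.prems] by simp
qed (auto intro: trig_poly_continuous)

lemma trig_poly_test_function:
  assumes "0 < L" "trig_poly L p"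
  shows "p \<in> test_functions L"
proof -
  have "p (x + L *\<^sub>R axis i 1) = p x" for i x
  proof (rule trig_poly_periodic[OF assms])
    show "\<exists>m::int. (L *\<^sub>R axis i 1 :: real ^ 'a) $ j = L * m" for j
      by (intro exI[of _ "if j = i then 1 else 0"]) (simp add: axis_def)
  qed
  then show ?thesis
    using assms by (auto simp: test_functions_def trig_poly_C_k)
qed

lemma trig_poly_L2: "trig_poly L p \<Longrightarrow> p \<in> L2 L"
  by (rule L2_continuous[OF trig_poly_continuous])

subsection \<open>Density of trigonometric polynomials\<close>

text \<open>The quotient map from the closed cube to the torus, realised as a product of circles in
  Euclidean space. Its coordinates are themselves modes.\<close>

definition circle_map :: "real \<Rightarrow> real ^ 'n \<Rightarrow> (real ^ 'n) \<times> (real ^ 'n)" where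
  "circle_map L x = ((\<chi> i. cos (2 * pi / L * x $ i)), (\<chi> i. sin (2 * pi / L * x $ i)))"

lemma circle_map_continuous: "continuous_on S (circle_map L)"
  unfolding circle_map_def
  by (intro continuous_intros)

text \<open>Equal angles in coordinate \<open>i\<close> come from values that differ by a multiple
  of the period, and two different such values in the interval from 0 to \<open>L\<close> can only
  be its ends. So a function vanishing off the open box respects the identification.\<close>

lemma circle_map_eq_imp_boundary:
  fixes x y :: "real ^ 'n"
  assumes "0 < L" "x \<in> cbox 0 (\<chi> i. L)" "y \<in> cbox 0 (\<chi> i. L)"
    and eq: "circle_map L x = circle_map L y" and ne: "x \<noteq> y"
  shows "x \<notin> box 0 (\<chi> i. L) \<and> y \<notin> box 0 (\<chi> i. L)"
proof -
  obtain i where i: "x $ i \<noteq> y $ i"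
    using ne by (auto simp: vec_eq_iff)
  have "cos (2 * pi / L * x $ i) = cos (2 * pi / L * y $ i)
      \<and> sin (2 * pi / L * x $ i) = sin (2 * pi / L * y $ i)"
    using eq by (simp add: circle_map_def vec_eq_iff)
  then obtain n :: int where "2 * pi / L * x $ i = 2 * pi / L * y $ i + 2 * pi * n"
    using sin_cos_eq_iff by blast
  then have "2 * pi * x $ i = 2 * pi * (y $ i + n * L)"
    using \<open>0 < L\<close> by (simp add: field_simps)
  then have n: "x $ i - y $ i = n * L"
    by simp
  have bounds: "0 \<le> x $ i" "x $ i \<le> L" "0 \<le> y $ i" "y $ i \<le> L"
    using assms(2,3) by (auto simp: mem_box_cart)
  have "\<bar>of_int n * L\<bar> \<le> 1 * L"
    unfolding n[symmetric] using bounds by linarith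
  then have "\<bar>of_int n :: real\<bar> \<le> 1"
    using \<open>0 < L\<close> by (simp add: abs_mult)
  then have "n = -1 \<or> n = 0 \<or> n = 1"
    by linarith
  then have "x $ i - y $ i = L \<or> x $ i - y $ i = - L"
    using n i by auto
  then have "(x $ i = 0 \<or> x $ i = L) \<and> (y $ i = 0 \<or> y $ i = L)"
    using bounds by linarith
  then show ?thesis
    by (auto simp: mem_box_cart intro!: exI[of _ i])
qed

lemma trig_poly_circle_map:
  assumes "0 < L"
  shows "trig_poly L (\<lambda>x :: real ^ 'n. fst (circle_map L x) $ i)"
    and "trig_poly L (\<lambda>x :: real ^ 'n. snd (circle_map L x) $ i)"
proof -
  have k: "\<exists>m::int. (axis i (2 * pi / L) :: real ^ 'n) $ j = 2 * pi * m / L" for j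
    by (intro exI[of _ "if j = i then 1 else 0"]) (simp add: axis_def)
  have "axis i (2 * pi / L) \<bullet> x = 2 * pi / L * x $ i" for x :: "real ^ 'n"
    by (simp add: inner_axis')
  then show "trig_poly L (\<lambda>x :: real ^ 'n. fst (circle_map L x) $ i)"
    and "trig_poly L (\<lambda>x :: real ^ 'n. snd (circle_map L x) $ i)"
    using trig_poly.mode[OF k, of 1 0] trig_poly.mode[OF k, of 1 "- pi / 2"]
    by (simp_all add: circle_map_def cos_diff)
qed

text \<open>A continuous map on a compact set is closed onto its image, hence a quotient map: the
  preimage of a closed set under the lift is the image of a compact set.\<close>

lemma continuous_on_quotient_lift:
  fixes q :: "'a::metric_space \<Rightarrow> 'b::metric_space" and \<psi> :: "'a \<Rightarrow> 'c::metric_space"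
  assumes "compact S" "continuous_on S q" "continuous_on S \<psi>"
    and "\<And>x y. x \<in> S \<Longrightarrow> y \<in> S \<Longrightarrow> q x = q y \<Longrightarrow> \<psi> x = \<psi> y"
  obtains \<Psi> where "continuous_on (q ` S) \<Psi>" "\<And>x. x \<in> S \<Longrightarrow> \<Psi> (q x) = \<psi> x"
proof
  define \<Psi> where "\<Psi> y = \<psi> (SOME x. x \<in> S \<and> q x = y)" for y
  show lift: "\<Psi> (q x) = \<psi> x" if "x \<in> S" for x
  proof -
    have "(SOME z. z \<in> S \<and> q z = q x) \<in> S \<and> q (SOME z. z \<in> S \<and> q z = q x) = q x"
      by (rule someI[of _ x]) (simp add: that)
    then show ?thesis
      unfolding \<Psi>_def by (intro assms(4) that) auto
  qed
  show "continuous_on (q ` S) \<Psi>"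
    unfolding continuous_on_closed_vimage[OF compact_imp_closed[OF compact_continuous_image[OF assms(2,1)]]]
  proof (intro allI impI)
    fix B :: "'c set" assume "closed B"
    have "closedin (top_of_set S) (S \<inter> \<psi> -` B)"
      using assms(3) \<open>closed B\<close> by (rule continuous_closedin_preimage)
    then have "compact (S \<inter> \<psi> -` B)"
      using assms(1) closedin_compact by blast
    then have "compact (q ` (S \<inter> \<psi> -` B))"
      using assms(2) by (auto intro: compact_continuous_image continuous_on_subset)
    also have "q ` (S \<inter> \<psi> -` B) = \<Psi> -` B \<inter> q ` S"
      using lift by auto
    finally show "closed (\<Psi> -` B \<inter> q ` S)"
      by (rule compact_imp_closed)
  qed
qed

lemma trig_poly_dense:
  fixes \<psi> :: "real ^ 'n \<Rightarrow> real"
  assumes "0 < L" "0 < e" "continuous_on UNIV \<psi>" "\<And>x. x \<notin> box 0 (\<chi> i. L) \<Longrightarrow> \<psi> x = 0"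
  obtains p where "trig_poly L p" "\<And>x. x \<in> cell L \<Longrightarrow> \<bar>\<psi> x - p x\<bar> < e"
proof -
  let ?C = "cbox 0 (\<chi> i. L) :: (real ^ 'n) set"
  have "continuous_on ?C \<psi>"
    using assms(3) continuous_on_subset by blast
  moreover have "\<psi> x = \<psi> y" if "x \<in> ?C" "y \<in> ?C" "circle_map L x = circle_map L y" for x y
    using circle_map_eq_imp_boundary[OF assms(1) that] assms(4) by metis
  ultimately obtain \<Psi> where \<Psi>: "continuous_on (circle_map L ` ?C) \<Psi>"
      "\<And>x. x \<in> ?C \<Longrightarrow> \<Psi> (circle_map L x) = \<psi> x"
    using continuous_on_quotient_lift[OF compact_cbox circle_map_continuous] by metis
  \<comment> \<open>Membership in \<open>R\<close> already records that the pullback is a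
    trigonometric polynomial, so the approximant found on the image can be read back on the
    cell.\<close>
  define R where "R = {F. continuous_on (circle_map L ` ?C) F
      \<and> trig_poly L (\<lambda>x. F (circle_map L x))}"
  interpret function_ring_on R "circle_map L ` ?C"
  proof
    show "compact (circle_map L ` ?C)"
      by (intro compact_continuous_image circle_map_continuous compact_cbox)
    fix x y :: "(real ^ 'n) \<times> (real ^ 'n)" assume ne: "x \<noteq> y"
    have mem: "(\<lambda>z. fst z $ i) \<in> R" "(\<lambda>z. snd z $ i) \<in> R" for i
      using trig_poly_circle_map[OF assms(1), of i] by (auto simp: R_def intro!: continuous_intros)
    show "\<exists>f\<in>R. f x \<noteq> f y"
    proof (cases "fst x = fst y")
      case True
      then obtain i where "snd x $ i \<noteq> snd y $ i"
        using ne by (auto simp: prod_eq_iff vec_eq_iff)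
      then show ?thesis
        using mem(2) by (intro bexI[of _ "\<lambda>z. snd z $ i"])
    next
      case False
      then obtain i where "fst x $ i \<noteq> fst y $ i"
        by (auto simp: vec_eq_iff)
      then show ?thesis
        using mem(1) by (intro bexI[of _ "\<lambda>z. fst z $ i"])
    qed
  qed (auto simp: R_def trig_poly_const trig_poly_mult intro: trig_poly.add continuous_intros)
  obtain F where F: "F \<in> R" "\<And>z. z \<in> circle_map L ` ?C \<Longrightarrow> \<bar>\<Psi> z - F z\<bar> < e"
    using Stone_Weierstrass_basic[OF \<Psi>(1) assms(2)] by blast
  show thesis
  proof
    show "trig_poly L (\<lambda>x. F (circle_map L x))"
      using F(1) by (simp add: R_def)
    show "\<bar>\<psi> x - F (circle_map L x)\<bar> < e" if "x \<in> cell L" for x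
      using that cell_subset_cbox[of L] F(2)[of "circle_map L x"] \<Psi>(2)[of x] by auto
  qed
qed

section \<open>From integrals against trigonometric polynomials to signs almost everywhere\<close>

text \<open>An approximant \<open>p\<close> with error \<open>e\<close> may be slightly negative,
  but \<open>p + e\<close> is non-negative everywhere and stays within \<open>2 * e\<close> of
  \<open>\<psi>\<close> on the cell. The cost is at most \<open>2 * e\<close> times the integral of
  the absolute value of \<open>g\<close>.\<close>

lemma trig_poly_nonneg_imp_continuous_nonneg:
  fixes g \<psi> :: "real ^ 'n \<Rightarrow> real"
  assumes L: "0 < L" and g: "g \<in> L2 L"
    and nonneg: "\<And>p. trig_poly L p \<Longrightarrow> (\<And>x. 0 \<le> p x) \<Longrightarrow> 0 \<le> (\<integral>x. g x * p x \<partial>torus L)"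
    and \<psi>: "continuous_on UNIV \<psi>" "\<And>x. x \<notin> box 0 (\<chi> i. L) \<Longrightarrow> \<psi> x = 0" "\<And>x. 0 \<le> \<psi> x"
  shows "0 \<le> (\<integral>x. g x * \<psi> x \<partial>torus L)"
proof (rule ccontr)
  assume neg: "\<not> ?thesis"
  define A where "A = (\<integral>x. \<bar>g x\<bar> \<partial>torus L)"
  \<comment> \<open>Chosen so that the error \<open>2 * e * A\<close> falls short of the deficit
    \<open>2 * e * (A + 1)\<close> by exactly \<open>2 * e\<close>; \<open>A + 1\<close> also keeps
    the denominator positive when \<open>A = 0\<close>.\<close>
  define e where "e = - (\<integral>x. g x * \<psi> x \<partial>torus L) / (2 * (A + 1))"
  have "0 \<le> A"
    by (simp add: A_def)
  then have "0 < e"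
    using neg by (simp add: e_def divide_neg_pos)
  obtain p where p: "trig_poly L p" "\<And>x. x \<in> cell L \<Longrightarrow> \<bar>\<psi> x - p x\<bar> < e"
    using trig_poly_dense[OF L \<open>0 < e\<close> \<psi>(1,2)] by blast
  have p': "trig_poly L (\<lambda>x. p x + e)"
    by (intro trig_poly.add p trig_poly_const)
  have "0 \<le> p x + e" for x
  proof -
    obtain y where y: "y \<in> cell L" "\<And>p. trig_poly L p \<Longrightarrow> p y = p x"
      using trig_poly_cell_representative[OF L, of x] by metis
    have "\<bar>\<psi> y - p x\<bar> < e"
      using p(2)[OF y(1)] by (simp add: y(2)[OF p(1)])
    then show ?thesis
      using \<psi>(3)[of y] by linarith
  qed
  then have "0 \<le> (\<integral>x. g x * (p x + e) \<partial>torus L)"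
    by (rule nonneg[OF p'])
  also have "\<dots> \<le> (\<integral>x. g x * \<psi> x + \<bar>g x\<bar> * (2 * e) \<partial>torus L)"
  proof (rule integral_mono)
    show "integrable (torus L) (\<lambda>x. g x * (p x + e))"
      by (rule integrable_L2_mult[OF g trig_poly_L2[OF p']])
    show "integrable (torus L) (\<lambda>x. g x * \<psi> x + \<bar>g x\<bar> * (2 * e))"
      using integrable_L2_mult[OF g L2_continuous[OF \<psi>(1)]] integrable_L2[OF g] by auto
    fix x assume "x \<in> space (torus L :: (real ^ 'n) measure)"
    then have "\<bar>\<psi> x - p x\<bar> < e"
      using p(2) by simp
    then have "\<bar>p x + e - \<psi> x\<bar> \<le> 2 * e"
      by linarith
    then have "\<bar>g x\<bar> * \<bar>p x + e - \<psi> x\<bar> \<le> \<bar>g x\<bar> * (2 * e)"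
      by (intro mult_left_mono) auto
    then have "\<bar>g x * (p x + e - \<psi> x)\<bar> \<le> \<bar>g x\<bar> * (2 * e)"
      by (simp only: abs_mult)
    moreover have "g x * (p x + e) = g x * \<psi> x + g x * (p x + e - \<psi> x)"
      by (simp add: algebra_simps)
    ultimately show "g x * (p x + e) \<le> g x * \<psi> x + \<bar>g x\<bar> * (2 * e)"
      by linarith
  qed
  also have "\<dots> = (\<integral>x. g x * \<psi> x \<partial>torus L) + A * (2 * e)"
    using integrable_L2_mult[OF g L2_continuous[OF \<psi>(1)]] integrable_L2[OF g]
    by (simp add: A_def)
  also have "(\<integral>x. g x * \<psi> x \<partial>torus L) = - (e * (2 * (A + 1)))"
    using \<open>0 \<le> A\<close> by (simp add: e_def)
  also have "- (e * (2 * (A + 1))) + A * (2 * e) = - 2 * e"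
    by (simp add: algebra_simps)
  finally show False
    using \<open>0 < e\<close> by simp
qed

lemma cell_diff_box_negligible: "negligible (cell L - box (0 :: real ^ 'n) (\<chi> i. L))"
  by (rule negligible_subset[OF negligible_frontier_interval[of 0 "\<chi> i. L"]])
     (use cell_subset_cbox in blast)

text \<open>The negativity set of \<open>g\<close> is approximated almost everywhere by continuous functions, which
  a cutoff makes vanish outside the open cube.\<close>

lemma trig_poly_nonneg_imp_AE_nonneg:
  fixes g :: "real ^ 'n \<Rightarrow> real"
  assumes L: "0 < L" and g: "g \<in> L2 L"
    and nonneg: "\<And>p. trig_poly L p \<Longrightarrow> (\<And>x. 0 \<le> p x) \<Longrightarrow> 0 \<le> (\<integral>x. g x * p x \<partial>torus L)"
  shows "AE x in torus L. 0 \<le> g x"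
proof -
  let ?B = "box 0 (\<chi> i. L) :: (real ^ 'n) set"
  define E where "E = {x \<in> cell L. g x < 0}"
  have E: "E \<in> sets (torus L)"
    using g by (auto simp: E_def L2_def borel_measurable_iff_less)
  then have "E \<in> sets lebesgue"
    by (simp add: sets_restrict_space_iff)
  then have "(indicator E :: real ^ 'n \<Rightarrow> real) \<in> borel_measurable (lebesgue_on UNIV)"
    by (simp add: lebesgue_on_UNIV_eq)
  then have "(indicator E :: real ^ 'n \<Rightarrow> real) measurable_on UNIV"
    by (subst measurable_on_iff_borel_measurable) auto
  then obtain N and G :: "nat \<Rightarrow> real ^ 'n \<Rightarrow> real"
    where N: "negligible N" and G: "\<And>n. continuous_on UNIV (G n)"
    and lim: "\<And>x. x \<notin> N \<Longrightarrow> (\<lambda>n. G n x) \<longlonglongrightarrow> indicator E x"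
    unfolding measurable_on_def by auto
  have "0 \<notin> ?B"
    by (simp add: mem_box_cart)
  \<comment> \<open>\<open>infdist\<close> to the empty set is 0 by convention, so the cutoff below
    has to know that the complement is inhabited.\<close>
  then have ne: "- ?B \<noteq> {}"
    by blast
  \<comment> \<open>Clamping to the unit interval preserves the pointwise limit, since an indicator
    only takes the values 0 and 1, and it provides the dominating bound. The distance factor
    vanishes off the box and is eventually 1 at each point inside.\<close>
  define \<psi> where "\<psi> n x = max 0 (min 1 (G n x)) * min 1 (real n * infdist x (- ?B))" for n x
  have cont: "continuous_on UNIV (\<psi> n)" for n
    unfolding \<psi>_def by (intro continuous_intros G)
  have "0 \<le> (\<integral>x. g x * \<psi> n x \<partial>torus L)" for n
    by (rule trig_poly_nonneg_imp_continuous_nonneg[OF L g nonneg cont])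
       (auto simp: \<psi>_def infdist_nonneg)
  moreover have "(\<lambda>n. \<integral>x. g x * \<psi> n x \<partial>torus L) \<longlonglongrightarrow> (\<integral>x. g x * indicator E x \<partial>torus L)"
  proof (rule integral_dominated_convergence[where w="\<lambda>x. \<bar>g x\<bar>"])
    show "(\<lambda>x. g x * indicator E x) \<in> borel_measurable (torus L)"
      using E g by (auto simp: L2_def)
    show "(\<lambda>x. g x * \<psi> n x) \<in> borel_measurable (torus L)" for n
      using integrable_L2_mult[OF g L2_continuous[OF cont]] by simp
    show "integrable (torus L) (\<lambda>x. \<bar>g x\<bar>)"
      using integrable_L2[OF g] by simp
    have "\<bar>\<psi> n x\<bar> \<le> 1" for n x
      by (auto simp: \<psi>_def infdist_nonneg abs_mult intro!: mult_le_one)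
    then have "\<bar>g x\<bar> * \<bar>\<psi> n x\<bar> \<le> \<bar>g x\<bar> * 1" for n x
      by (intro mult_left_mono) auto
    then show "AE x in torus L. norm (g x * \<psi> n x) \<le> \<bar>g x\<bar>" for n
      by (simp add: abs_mult)
    have "AE x in lebesgue. x \<notin> N" "AE x in lebesgue. x \<notin> cell L - ?B"
      by (rule N[unfolded negligible_iff_null_sets, THEN AE_not_in]
          cell_diff_box_negligible[unfolded negligible_iff_null_sets, THEN AE_not_in])+
    then have "AE x in lebesgue. x \<in> cell L \<longrightarrow> (\<lambda>n. g x * \<psi> n x) \<longlonglongrightarrow> g x * indicator E x"
    proof eventually_elim
      case (elim x)
      show ?case
      proof
        assume "x \<in> cell L"
        then have "infdist x (- ?B) > 0"
          using elim ne infdist_pos_not_in_closed[of "- ?B" x] by auto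
        then have "filterlim (\<lambda>n. real n * infdist x (- ?B)) at_top sequentially"
          by (intro filterlim_at_top_mult_tendsto_pos[OF tendsto_const] filterlim_real_sequentially)
        then have "eventually (\<lambda>n. min 1 (real n * infdist x (- ?B)) = 1) sequentially"
          by (auto simp: filterlim_at_top min_def elim: eventually_mono dest!: spec[of _ 1])
        then have "(\<lambda>n. min 1 (real n * infdist x (- ?B))) \<longlonglongrightarrow> 1"
          by (rule tendsto_eventually)
        moreover have "(\<lambda>n. max 0 (min 1 (G n x))) \<longlonglongrightarrow> max 0 (min 1 (indicator E x))"
          by (intro tendsto_intros lim elim)
        ultimately have "(\<lambda>n. \<psi> n x) \<longlonglongrightarrow> max 0 (min 1 (indicator E x)) * 1"
          unfolding \<psi>_def by (intro tendsto_mult)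
        moreover have "max 0 (min 1 (indicator E x)) * 1 = (indicator E x :: real)"
          by (simp add: indicator_def)
        ultimately show "(\<lambda>n. g x * \<psi> n x) \<longlonglongrightarrow> g x * indicator E x"
          by (intro tendsto_mult tendsto_const) simp
      qed
    qed
    then show "AE x in torus L. (\<lambda>n. g x * \<psi> n x) \<longlonglongrightarrow> g x * indicator E x"
      by (simp add: AE_restrict_space_iff)
  qed
  ultimately have "0 \<le> (\<integral>x. g x * indicator E x \<partial>torus L)"
    by (intro LIMSEQ_le_const) auto
  moreover have int: "integrable (torus L) (\<lambda>x. - (g x * indicator E x))"
    using integrable_real_mult_indicator[OF E integrable_L2[OF g]] by simp
  moreover have pos: "AE x in torus L. 0 \<le> - (g x * indicator E x)"
    by (auto simp: E_def indicator_def)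
  \<comment> \<open>The product is negative on \<open>E\<close> and 0 elsewhere, so its non-negative
    integral has to vanish and \<open>E\<close> is null.\<close>
  ultimately have "(\<integral>x. - (g x * indicator E x) \<partial>torus L) = 0"
    using integral_nonneg_AE[OF pos] by simp
  then have "AE x in torus L. - (g x * indicator E x) = 0"
    using integral_nonneg_eq_0_iff_AE[OF int pos] by simp
  moreover have "AE x in torus L. x \<in> cell L"
    by (rule AE_I2) simp
  ultimately show ?thesis
    by eventually_elim (auto simp: E_def indicator_def split: if_splits)
qed

text \<open>Orthogonality gives the hypothesis of the sign criterion both for \<open>g\<close> and
  for \<open>- g\<close>.\<close>

lemma trig_poly_orthogonal_imp_AE_zero:
  fixes g :: "real ^ 'n \<Rightarrow> real"
  assumes L: "0 < L" and g: "g \<in> L2 L"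
    and zero: "\<And>p. trig_poly L p \<Longrightarrow> (\<integral>x. g x * p x \<partial>torus L) = 0"
  shows "AE x in torus L. g x = 0"
proof -
  have "(\<lambda>x. 0 - g x) \<in> L2 L"
    by (intro L2_diff g L2_continuous continuous_on_const)
  then have "AE x in torus L. 0 \<le> 0 - g x"
    using zero by (intro trig_poly_nonneg_imp_AE_nonneg L) auto
  moreover have "AE x in torus L. 0 \<le> g x"
    using zero by (intro trig_poly_nonneg_imp_AE_nonneg L g) auto
  ultimately show ?thesis
    by eventually_elim simp
qed

subsection \<open>Weak gradients\<close>

lemma has_weak_grad_weak_grad: "u \<in> H1 L \<Longrightarrow> has_weak_grad L u (weak_grad L u)"
  unfolding H1_def weak_grad_def mem_Collect_eq by (intro someI_ex[of "has_weak_grad L u"]) blast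

text \<open>Both candidates obey the same identity against every trigonometric polynomial, so the
  difference of their components is orthogonal to all of them. This is what identifies the choice
  \<open>weak_grad\<close> with an explicitly computed gradient.\<close>

lemma has_weak_grad_unique:
  fixes u :: "real ^ 'n \<Rightarrow> real"
  assumes "0 < L" "has_weak_grad L u G" "has_weak_grad L u H"
  shows "AE x in torus L. G x = H x"
proof -
  have "AE x in torus L. G x $ i - H x $ i = 0" for i
  proof (rule trig_poly_orthogonal_imp_AE_zero[OF assms(1)])
    have G: "(\<lambda>x. G x $ i) \<in> L2 L" and H: "(\<lambda>x. H x $ i) \<in> L2 L"
      using assms(2,3) by (auto simp: has_weak_grad_def)
    show "(\<lambda>x. G x $ i - H x $ i) \<in> L2 L"
      using G H by (rule L2_diff)
    fix p :: "real ^ 'n \<Rightarrow> real" assume p: "trig_poly L p"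
    have "(\<integral>x. u x * partial_deriv i p x \<partial>torus L) = - (\<integral>x. G x $ i * p x \<partial>torus L)"
      "(\<integral>x. u x * partial_deriv i p x \<partial>torus L) = - (\<integral>x. H x $ i * p x \<partial>torus L)"
      using assms(2,3) trig_poly_test_function[OF assms(1) p] unfolding has_weak_grad_def by blast+
    then show "(\<integral>x. (G x $ i - H x $ i) * p x \<partial>torus L) = 0"
      using integrable_L2_mult[OF G trig_poly_L2[OF p]] integrable_L2_mult[OF H trig_poly_L2[OF p]]
      by (simp add: left_diff_distrib)
  qed
  then have "AE x in torus L. \<forall>i\<in>UNIV. G x $ i - H x $ i = 0"
    by (intro AE_finite_allI) auto
  then show ?thesis
    by eventually_elim (simp add: vec_eq_iff)
qed

section \<open>Translation invariance and integration by parts on the torus\<close>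

lemma lborel_integrable_translate:
  fixes g :: "'a::euclidean_space \<Rightarrow> real"
  assumes "integrable lborel g"
  shows "integrable lborel (\<lambda>x. g (c + x))"
  using integrable_distr[of "(+) c" lborel borel g] assms by (simp add: lborel_distr_plus)

lemma lborel_integral_translate:
  fixes g :: "'a::euclidean_space \<Rightarrow> real"
  assumes "g \<in> borel_measurable borel"
  shows "(\<integral>x. g (c + x) \<partial>lborel) = (\<integral>x. g x \<partial>lborel)"
  using integral_distr[of "(+) c" lborel borel g] assms by (simp add: lborel_distr_plus)

lemma integral_torus_eq_lborel:
  fixes F :: "real ^ 'n \<Rightarrow> real"
  assumes "F \<in> borel_measurable borel"
  shows "(\<integral>x. F x \<partial>torus L) = (\<integral>x. indicator (cell L) x * F x \<partial>lborel)"
  using assms by (simp add: integral_restrict_space integral_completion)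

text \<open>The shifted cell overhangs the original one by a slab of thickness \<open>t\<close>, and
  periodicity allows the slab to be put back by one translation by \<open>L\<close>.\<close>

lemma integral_torus_translate:
  fixes F :: "real ^ 'n \<Rightarrow> real"
  assumes "0 < L" "continuous_on UNIV F" "\<And>x. F (x + L *\<^sub>R axis i 1) = F x" "0 \<le> t" "t \<le> L"
  shows "(\<integral>x. F (x + t *\<^sub>R axis i 1) \<partial>torus L) = (\<integral>x. F x \<partial>torus L)"
proof -
  define e :: "real ^ 'n" where "e = axis i 1"
  \<comment> \<open>The shifted cell is the disjoint union of \<open>A\<close> and of
    \<open>B\<close> moved by \<open>L *\<^sub>R e\<close>; \<open>t \<le> L\<close> ensures that
    one period is enough.\<close>
  define A where "A = cell L \<inter> {x. t \<le> x $ i}"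
  define B where "B = cell L \<inter> {x. x $ i < t}"
  have [measurable]: "F \<in> borel_measurable borel"
    using assms(2) by (rule borel_measurable_continuous_onI)
  have [measurable]: "A \<in> sets borel" "B \<in> sets borel"
    unfolding A_def B_def
    by (intro sets.Int cell_borel borel_closed borel_open closed_halfspace_component_ge_cart
        open_halfspace_component_lt_cart)+
  have int: "integrable lborel (\<lambda>x. indicator S x * F x)" if "S \<subseteq> cell L" "S \<in> sets borel" for S
  proof -
    have "set_integrable lborel (cbox 0 (\<chi> i. L)) F"
      unfolding set_integrable_def using assms(2)
      by (intro borel_integrable_compact) (auto intro: continuous_on_subset)
    then have "set_integrable lborel S F"
      by (rule set_integrable_subset) (use that cell_subset_cbox[of L] in auto)
    then show ?thesis by (simp add: set_integrable_def)
  qed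
  have subs: "A \<subseteq> cell L" "B \<subseteq> cell L"
    by (auto simp: A_def B_def)
  have split: "indicator (cell L) (- (t *\<^sub>R e) + x)
      = (indicator A x + indicator B (- (L *\<^sub>R e) + x) :: real)" for x
  proof -
    have e: "(- (s *\<^sub>R e) + x) $ j = (if j = i then x $ i - s else x $ j)" for s j
      by (auto simp: e_def axis_def)
    have "(- (t *\<^sub>R e) + x) \<in> cell L \<longleftrightarrow> x \<in> A \<or> (- (L *\<^sub>R e) + x) \<in> B"
      "\<not> (x \<in> A \<and> (- (L *\<^sub>R e) + x) \<in> B)"
    proof -
      define R where "R \<longleftrightarrow> (\<forall>j. j \<noteq> i \<longrightarrow> 0 \<le> x $ j \<and> x $ j < L)"
      have c: "(- (s *\<^sub>R e) + x) \<in> cell L \<longleftrightarrow> 0 \<le> x $ i - s \<and> x $ i - s < L \<and> R" for s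
        unfolding cell_def mem_Collect_eq e R_def by (auto split: if_splits)
      have "x \<in> A \<longleftrightarrow> 0 \<le> x $ i \<and> x $ i < L \<and> R \<and> t \<le> x $ i"
        using c[of 0] by (auto simp: A_def)
      moreover have "(- (L *\<^sub>R e) + x) \<in> B \<longleftrightarrow> 0 \<le> x $ i - L \<and> x $ i - L < L \<and> R \<and> x $ i - L < t"
        using c[of L] e[of L i] by (auto simp: B_def)
      ultimately show "(- (t *\<^sub>R e) + x) \<in> cell L \<longleftrightarrow> x \<in> A \<or> (- (L *\<^sub>R e) + x) \<in> B"
        "\<not> (x \<in> A \<and> (- (L *\<^sub>R e) + x) \<in> B)"
        using c[of t] assms(4,5) by auto
    qed
    then show ?thesis by (auto simp: indicator_def)
  qed
  have per: "F (- (L *\<^sub>R e) + x) = F x" for x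
    using assms(3)[of "- (L *\<^sub>R e) + x"] by (simp add: e_def)
  have "(\<lambda>x. F (x + t *\<^sub>R e)) \<in> borel_measurable borel"
    by measurable
  then have "(\<integral>x. F (x + t *\<^sub>R e) \<partial>torus L)
      = (\<integral>x. indicator (cell L) x * F (x + t *\<^sub>R e) \<partial>lborel)"
    by (rule integral_torus_eq_lborel)
  also have "\<dots> = (\<integral>x. indicator (cell L) (- (t *\<^sub>R e) + (t *\<^sub>R e + x)) * F (t *\<^sub>R e + x) \<partial>lborel)"
    by (simp add: add.commute)
  also have "\<dots> = (\<integral>x. indicator (cell L) (- (t *\<^sub>R e) + x) * F x \<partial>lborel)"
    by (rule lborel_integral_translate) measurable
  also have "\<dots> = (\<integral>x. indicator A x * F x
      + indicator B (- (L *\<^sub>R e) + x) * F (- (L *\<^sub>R e) + x) \<partial>lborel)"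
    by (simp only: split per distrib_right)
  also have "\<dots> = (\<integral>x. indicator A x * F x \<partial>lborel) + (\<integral>x. indicator B x * F x \<partial>lborel)"
    using int[OF subs(1)] lborel_integrable_translate[OF int[OF subs(2)], of "- (L *\<^sub>R e)"]
      lborel_integral_translate[of "\<lambda>x. indicator B x * F x" "- (L *\<^sub>R e)"]
    by simp
  also have "\<dots> = (\<integral>x. indicator A x * F x + indicator B x * F x \<partial>lborel)"
    using int[OF subs(1)] int[OF subs(2)] by simp
  also have "\<dots> = (\<integral>x. indicator (cell L) x * F x \<partial>lborel)"
    by (intro Bochner_Integration.integral_cong) (auto simp: A_def B_def indicator_def)
  also have "\<dots> = (\<integral>x. F x \<partial>torus L)"
    by (rule integral_torus_eq_lborel[symmetric]) measurable
  finally show ?thesis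
    by (simp add: e_def)
qed

lemma has_real_derivative_along_axis:
  assumes "\<psi> differentiable (at (x + s *\<^sub>R axis i 1))"
  shows "((\<lambda>s. \<psi> (x + s *\<^sub>R axis i 1)) has_real_derivative partial_deriv i \<psi> (x + s *\<^sub>R axis i 1))
    (at s)"
proof -
  let ?D = "frechet_derivative \<psi> (at (x + s *\<^sub>R axis i 1))"
  have D: "(\<psi> has_derivative ?D) (at (x + s *\<^sub>R axis i 1))"
    using assms by (simp add: frechet_derivative_works)
  have "((\<lambda>s. \<psi> (x + s *\<^sub>R axis i 1)) has_derivative (\<lambda>h. ?D (h *\<^sub>R axis i 1))) (at s)"
    by (rule has_derivative_compose[where f="\<lambda>s. x + s *\<^sub>R axis i 1" and g=\<psi>, OF _ D])
       (auto intro!: derivative_eq_intros)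
  moreover have "?D (h *\<^sub>R axis i 1) = partial_deriv i \<psi> (x + s *\<^sub>R axis i 1) * h" for h
    using linear_cmul[OF has_derivative_linear[OF D]] by (simp add: partial_deriv_def)
  ultimately show ?thesis
    by (simp add: has_field_derivative_def)
qed

text \<open>The difference quotients along an axis have mean zero by translation invariance.\<close>

lemma integral_torus_partial_deriv:
  fixes \<psi> :: "real ^ 'n \<Rightarrow> real"
  assumes L: "0 < L" and diff: "\<And>x. \<psi> differentiable (at x)"
    and cont: "continuous_on UNIV (partial_deriv i \<psi>)"
    and per: "\<And>x. \<psi> (x + L *\<^sub>R axis i 1) = \<psi> x"
  shows "(\<integral>x. partial_deriv i \<psi> x \<partial>torus L) = 0"
proof -
  define e :: "real ^ 'n" where "e = axis i 1"
  \<comment> \<open>Positive steps tending to 0 and at most \<open>L\<close>, the range in which the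
    integral is known to be invariant under the shift.\<close>
  define t where "t n = L / real (Suc n)" for n
  have t: "0 < t n" "t n \<le> L" for n
    using L by (auto simp: t_def field_simps)
  have t_lim: "t \<longlonglongrightarrow> 0"
    unfolding t_def by (rule LIMSEQ_Suc[OF lim_const_over_n])
  have \<psi>_cont: "continuous_on UNIV \<psi>"
    using diff by (intro continuous_at_imp_continuous_on ballI differentiable_imp_continuous_within)
  have \<psi>_cont_shift: "continuous_on UNIV (\<lambda>x. \<psi> (x + s *\<^sub>R e))" for s
    by (intro continuous_on_compose2[OF \<psi>_cont] continuous_intros) auto
  define \<delta> where "\<delta> n x = (\<psi> (x + t n *\<^sub>R e) - \<psi> x) / t n" for n x
  have \<delta>_cont: "continuous_on UNIV (\<delta> n)" for n
    unfolding \<delta>_def using t(1)[of n] by (intro continuous_intros \<psi>_cont \<psi>_cont_shift) auto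
  have \<delta>_zero: "(\<integral>x. \<delta> n x \<partial>torus L) = 0" for n
  proof -
    have "(\<integral>x. \<psi> (x + t n *\<^sub>R e) \<partial>torus L) = (\<integral>x. \<psi> x \<partial>torus L)"
      unfolding e_def using t[of n] by (intro integral_torus_translate L \<psi>_cont per) auto
    then show ?thesis
      unfolding \<delta>_def
      using integrable_L2[OF L2_continuous[OF \<psi>_cont], of L]
        integrable_L2[OF L2_continuous[OF \<psi>_cont_shift], of L]
      by simp
  qed
  \<comment> \<open>Difference quotients are values of the derivative at intermediate points. These
    lie in a cube of side \<open>2 * L\<close>, because a step is at most \<open>L\<close>, so a
    compactness bound there dominates all quotients.\<close>
  have "compact (partial_deriv i \<psi> ` cbox 0 (\<chi> i. 2 * L))"
    using cont by (intro compact_continuous_image) (auto intro: continuous_on_subset)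
  then obtain M where M: "\<And>y. y \<in> cbox 0 (\<chi> i. 2 * L) \<Longrightarrow> \<bar>partial_deriv i \<psi> y\<bar> \<le> M"
    using compact_imp_bounded[THEN bounded_iff[THEN iffD1]] by (metis image_eqI real_norm_def)
  have bound: "\<bar>\<delta> n x\<bar> \<le> M" if "x \<in> cell L" for n x
  proof -
    obtain s where s: "0 < s" "s < t n"
      "\<psi> (x + t n *\<^sub>R e) - \<psi> (x + 0 *\<^sub>R e) = (t n - 0) * partial_deriv i \<psi> (x + s *\<^sub>R e)"
      using MVT2[OF t(1)[of n], of "\<lambda>s. \<psi> (x + s *\<^sub>R e)" "\<lambda>s. partial_deriv i \<psi> (x + s *\<^sub>R e)"]
        has_real_derivative_along_axis[OF diff] unfolding e_def by blast
    have "s \<le> L"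
      using s(2) t(2)[of n] by linarith
    have "0 \<le> (x + s *\<^sub>R e) $ j \<and> (x + s *\<^sub>R e) $ j \<le> 2 * L" for j
    proof -
      have "0 \<le> x $ j" "x $ j < L"
        using that by (auto simp: cell_def)
      then show ?thesis
        using s(1) \<open>s \<le> L\<close> L by (auto simp: e_def axis_def)
    qed
    then have "x + s *\<^sub>R e \<in> cbox 0 (\<chi> i. 2 * L)"
      by (simp add: mem_box_cart)
    then have "\<bar>partial_deriv i \<psi> (x + s *\<^sub>R e)\<bar> \<le> M"
      by (rule M)
    moreover have "\<delta> n x = partial_deriv i \<psi> (x + s *\<^sub>R e)"
      using s(3) t(1)[of n] by (simp add: \<delta>_def)
    ultimately show ?thesis by simp
  qed
  interpret finite_measure "torus L :: (real ^ 'n) measure"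
    by (rule finite_measure_torus)
  have "(\<lambda>n. \<integral>x. \<delta> n x \<partial>torus L) \<longlonglongrightarrow> (\<integral>x. partial_deriv i \<psi> x \<partial>torus L)"
  proof (rule integral_dominated_convergence[where w="\<lambda>_. M"])
    show "partial_deriv i \<psi> \<in> borel_measurable (torus L)"
      using L2_continuous[OF cont, of L] by (simp add: L2_def)
    show "\<delta> n \<in> borel_measurable (torus L)" for n
      using L2_continuous[OF \<delta>_cont, of n L] by (simp add: L2_def)
    show "AE x in torus L. norm (\<delta> n x) \<le> M" for n
      using bound by (intro AE_I2) auto
    show "AE x in torus L. (\<lambda>n. \<delta> n x) \<longlonglongrightarrow> partial_deriv i \<psi> x"
    proof (intro AE_I2)
      fix x
      have "((\<lambda>s. \<psi> (x + s *\<^sub>R e)) has_real_derivative partial_deriv i \<psi> (x + 0 *\<^sub>R e)) (at 0)"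
        unfolding e_def by (rule has_real_derivative_along_axis[OF diff])
      then have "((\<lambda>s. (\<psi> (x + s *\<^sub>R e) - \<psi> x) / s) \<longlongrightarrow> partial_deriv i \<psi> x) (at 0)"
        by (simp add: has_field_derivative_iff)
      moreover have "filterlim t (at 0) sequentially"
        using t(1) by (intro filterlim_atI t_lim) (auto intro!: always_eventually simp: less_imp_neq[symmetric])
      ultimately show "(\<lambda>n. \<delta> n x) \<longlonglongrightarrow> partial_deriv i \<psi> x"
        unfolding \<delta>_def by (rule filterlim_compose)
    qed
  qed simp
  then show ?thesis
    by (simp add: \<delta>_zero LIMSEQ_const_iff)
qed

text \<open>Integration by parts: the product with a test function is periodic, so its partial
  derivative has mean zero and no boundary term appears.\<close>

lemma has_weak_grad_trig_poly:
  fixes p :: "real ^ 'n \<Rightarrow> real"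
  assumes L: "0 < L" and p: "trig_poly L p"
  shows "has_weak_grad L p (\<lambda>x. \<chi> i. partial_deriv i p x)"
  unfolding has_weak_grad_def
proof (intro allI conjI ballI)
  fix i
  have dp: "trig_poly L (partial_deriv i p)"
    using p by (rule trig_poly_partial_deriv)
  then show "(\<lambda>x. (\<chi> i. partial_deriv i p x) $ i) \<in> L2 L"
    by (simp add: trig_poly_L2)
  fix \<phi> :: "real ^ 'n \<Rightarrow> real" assume \<phi>: "\<phi> \<in> test_functions L"
  then have "C_k 0 \<phi>" "C_k (Suc 0) \<phi>" and per: "\<phi> (x + L *\<^sub>R axis i 1) = \<phi> x" for x
    unfolding test_functions_def by blast+
  then have cont: "continuous_on UNIV \<phi>" "continuous_on UNIV (partial_deriv i \<phi>)"
    and diff: "\<And>x. \<phi> differentiable (at x)"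
    by auto
  note p_diff = trig_poly_differentiable[OF p]
  have eq: "partial_deriv i (\<lambda>x. p x * \<phi> x)
      = (\<lambda>x. p x * partial_deriv i \<phi> x + partial_deriv i p x * \<phi> x)"
    by (intro ext partial_deriv_mult p_diff diff)
  have "(\<integral>x. partial_deriv i (\<lambda>x. p x * \<phi> x) x \<partial>torus L) = 0"
  proof (rule integral_torus_partial_deriv[OF L])
    show "continuous_on UNIV (partial_deriv i (\<lambda>x. p x * \<phi> x))"
      unfolding eq
      by (intro continuous_intros cont trig_poly_continuous[OF p] trig_poly_continuous[OF dp])
    have "p \<in> test_functions L"
      by (rule trig_poly_test_function[OF L p])
    then show "p (x + L *\<^sub>R axis i 1) * \<phi> (x + L *\<^sub>R axis i 1) = p x * \<phi> x" for x
      by (simp add: per test_functions_def)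
  qed (intro differentiable_mult p_diff diff)
  then show "(\<integral>x. p x * partial_deriv i \<phi> x \<partial>torus L)
      = - (\<integral>x. (\<chi> i. partial_deriv i p x) $ i * \<phi> x \<partial>torus L)"
    using integrable_L2_mult[OF trig_poly_L2[OF p] L2_continuous[OF cont(2)]]
      integrable_L2_mult[OF trig_poly_L2[OF dp] L2_continuous[OF cont(1)]]
    by (simp add: eq)
qed

lemma trig_poly_H1:
  assumes "0 < L" "trig_poly L p"
  shows "p \<in> H1 L"
  using has_weak_grad_trig_poly[OF assms] trig_poly_L2[OF assms(2)] by (auto simp: H1_def)

lemma weak_grad_trig_poly:
  fixes p :: "real ^ 'n \<Rightarrow> real"
  assumes "0 < L" "trig_poly L p"
  shows "AE x in torus L. weak_grad L p x = (\<chi> i. partial_deriv i p x)"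
  by (rule has_weak_grad_unique[OF assms(1) has_weak_grad_weak_grad[OF trig_poly_H1[OF assms]]
        has_weak_grad_trig_poly[OF assms]])

subsection \<open>The resolvent on trigonometric polynomials\<close>

text \<open>Each mode is an eigenfunction of the Laplacian with eigenvalue
  \<open>- (k \<bullet> k)\<close>. Solving the equation therefore only rescales its amplitude by
  \<open>a / (a + k \<bullet> k)\<close>, and linearity adds up the modes.\<close>

lemma trig_poly_resolvent:
  fixes p :: "real ^ 'n \<Rightarrow> real"
  assumes "0 < a" "trig_poly L p"
  shows "\<exists>w. trig_poly L w \<and>
    (\<forall>x. a * w x - (\<Sum>i\<in>UNIV. partial_deriv i (partial_deriv i w) x) = a * p x)"
  using assms(2)
proof (induction rule: trig_poly.induct)
  case (mode k c b)
  have pos: "a + k \<bullet> k > 0"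
    using assms(1) by (simp add: add_pos_nonneg)
  define c' where "c' = c * a / (a + k \<bullet> k)"
  have "partial_deriv i (partial_deriv i (\<lambda>x. c' * cos (k \<bullet> x + b))) x
      = - (c' * cos (k \<bullet> x + b)) * (k $ i * k $ i)" for i x
  proof -
    have "k \<bullet> x + (b + pi / 2 + pi / 2) = (k \<bullet> x + b) + pi"
      by simp
    then have "cos (k \<bullet> x + (b + pi / 2 + pi / 2)) = - cos (k \<bullet> x + b)"
      by (simp only: cos_periodic_pi)
    then show ?thesis
      by (simp only: partial_deriv_mode) (simp add: algebra_simps)
  qed
  then have "(\<Sum>i\<in>UNIV. partial_deriv i (partial_deriv i (\<lambda>x. c' * cos (k \<bullet> x + b))) x)
      = - (c' * cos (k \<bullet> x + b)) * (k \<bullet> k)" for x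
    by (simp only: inner_vec_def sum_distrib_left inner_real_def)
  then have "a * (c' * cos (k \<bullet> x + b))
      - (\<Sum>i\<in>UNIV. partial_deriv i (partial_deriv i (\<lambda>x. c' * cos (k \<bullet> x + b))) x)
      = (a + k \<bullet> k) * c' * cos (k \<bullet> x + b)" for x
    by (simp add: algebra_simps)
  moreover have "(a + k \<bullet> k) * c' = a * c"
    using pos by (simp add: c'_def)
  ultimately show ?case
    using trig_poly.mode[OF mode, of c' b] by (auto simp: mult.assoc)
next
  case (add p q)
  then obtain v w where v: "trig_poly L v"
      "\<And>x. a * v x - (\<Sum>i\<in>UNIV. partial_deriv i (partial_deriv i v) x) = a * p x"
    and w: "trig_poly L w"
      "\<And>x. a * w x - (\<Sum>i\<in>UNIV. partial_deriv i (partial_deriv i w) x) = a * q x"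
    by auto
  have "partial_deriv i (\<lambda>x. v x + w x) = (\<lambda>x. partial_deriv i v x + partial_deriv i w x)" for i
    using v(1) w(1) by (intro ext partial_deriv_add trig_poly_differentiable)
  moreover have "partial_deriv i (\<lambda>x. partial_deriv i v x + partial_deriv i w x)
      = (\<lambda>x. partial_deriv i (partial_deriv i v) x + partial_deriv i (partial_deriv i w) x)" for i
    using v(1) w(1)
    by (intro ext partial_deriv_add trig_poly_differentiable[OF trig_poly_partial_deriv])
  ultimately have "a * (v x + w x) - (\<Sum>i\<in>UNIV. partial_deriv i (partial_deriv i (\<lambda>x. v x + w x)) x)
      = a * (p x + q x)" for x
    using v(2)[of x] w(2)[of x] by (simp add: sum.distrib algebra_simps)
  then show ?case
    using trig_poly.add[OF v(1) w(1)] by blast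
qed

text \<open>If \<open>d < 0\<close>, then just to the right of the minimum \<open>g'\<close> is
  below its value 0 there, and by the mean value theorem \<open>g\<close> drops below its
  minimum.\<close>

lemma second_derivative_nonneg_at_min:
  fixes g g' :: "real \<Rightarrow> real"
  assumes "\<And>s. (g has_real_derivative g' s) (at s)" "(g' has_real_derivative d) (at x)"
    and "\<And>s. g x \<le> g s"
  shows "0 \<le> d"
proof (rule ccontr)
  assume "\<not> 0 \<le> d"
  then obtain r where r: "0 < r" "\<And>h. 0 < h \<Longrightarrow> h < r \<Longrightarrow> g' (x + h) < g' x"
    using has_real_derivative_neg_dec_right[OF assms(2)] by auto
  have "g' x = 0"
    using DERIV_local_min[OF assms(1), of 1 x] assms(3) by simp
  obtain z where z: "x < z" "z < x + r / 2" "g (x + r / 2) - g x = (x + r / 2 - x) * g' z"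
    using MVT2[of x "x + r / 2" g g'] assms(1) r(1) by auto
  have "g' z < 0"
    using r(2)[of "z - x"] z(1,2) r(1) \<open>g' x = 0\<close> by simp
  then have "g (x + r / 2) < g x"
    using z(3) mult_pos_neg[of "r / 2" "g' z"] r(1) by simp
  then show False
    using assms(3)[of "x + r / 2"] by simp
qed

text \<open>At a global minimum every pure second derivative is non-negative, so the differential
  inequality bounds \<open>a\<close> times the minimum from below by their non-negative sum.\<close>

lemma trig_poly_min_principle:
  fixes w :: "real ^ 'n \<Rightarrow> real"
  assumes L: "0 < L" and a: "0 < a" and w: "trig_poly L w"
    and super: "\<And>x. 0 \<le> a * w x - (\<Sum>i\<in>UNIV. partial_deriv i (partial_deriv i w) x)"
  shows "0 \<le> w x"
proof -
  have "(0 :: real ^ 'n) \<in> cbox 0 (\<chi> i. L)"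
    using L by (simp add: mem_box_cart)
  then have "cbox 0 (\<chi> i. L) \<noteq> ({} :: (real ^ 'n) set)"
    by blast
  then obtain x0 where x0: "\<And>y. y \<in> cbox 0 (\<chi> i. L) \<Longrightarrow> w x0 \<le> w y"
    using continuous_attains_inf[OF compact_cbox _ trig_poly_continuous[OF w]] by metis
  \<comment> \<open>By periodicity the minimum over the cube is global. This matters because
    \<open>x0\<close> may lie on a face, while the second derivative test looks at both sides along
    each axis.\<close>
  have min: "w x0 \<le> w z" for z
  proof -
    obtain y where y: "y \<in> cell L" "\<And>p. trig_poly L p \<Longrightarrow> p y = p z"
      using trig_poly_cell_representative[OF L, of z] by metis
    have "w x0 \<le> w y"
      using y(1) cell_subset_cbox by (intro x0) blast
    then show ?thesis
      using y(2)[OF w] by simp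
  qed
  have "0 \<le> partial_deriv i (partial_deriv i w) x0" for i
  proof (rule second_derivative_nonneg_at_min[where x=0])
    note w' = trig_poly_partial_deriv[OF w, of i]
    show "((\<lambda>s. w (x0 + s *\<^sub>R axis i 1)) has_real_derivative partial_deriv i w (x0 + s *\<^sub>R axis i 1))
      (at s)" for s
      by (rule has_real_derivative_along_axis[OF trig_poly_differentiable[OF w]])
    show "((\<lambda>s. partial_deriv i w (x0 + s *\<^sub>R axis i 1)) has_real_derivative
        partial_deriv i (partial_deriv i w) x0) (at 0)"
      using has_real_derivative_along_axis[where \<psi>="partial_deriv i w" and x=x0 and s=0 and i=i,
          OF trig_poly_differentiable[OF w']] by simp
  qed (use min in simp)
  then have "0 \<le> a * w x0"
    using super[of x0]
      sum_nonneg[where A=UNIV and f="\<lambda>i. partial_deriv i (partial_deriv i w) x0"] by simp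
  then have "0 \<le> w x0"
    using a by (simp add: zero_le_mult_iff)
  then show ?thesis
    using min[of x] by simp
qed

subsection \<open>Weak solutions\<close>

lemma weak_grad_L2: "u \<in> H1 L \<Longrightarrow> (\<lambda>x. weak_grad L u x $ i) \<in> L2 L"
  using has_weak_grad_weak_grad[of u L] by (simp add: has_weak_grad_def)

lemma integrable_weak_grad_inner:
  assumes "u \<in> H1 L" "v \<in> H1 L"
  shows "integrable (torus L) (\<lambda>x. weak_grad L u x \<bullet> weak_grad L v x)"
  unfolding inner_vec_def inner_real_def
  by (intro Bochner_Integration.integrable_sum integrable_L2_mult weak_grad_L2 assms)

lemma H1_L2: "u \<in> H1 L \<Longrightarrow> u \<in> L2 L"
  by (simp add: H1_def)

text \<open>Moves the resolvent from a weak solution onto its trigonometric test functions, so that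
  no truncation of Sobolev functions is needed for the comparison principle.\<close>

lemma weak_solution_adjoint:
  fixes f u p w :: "real ^ 'n \<Rightarrow> real"
  assumes L: "0 < L" and a: "0 < a" and u: "weak_solution L a f u" and w: "trig_poly L w"
    and res: "\<And>x. a * w x - (\<Sum>i\<in>UNIV. partial_deriv i (partial_deriv i w) x) = a * p x"
  shows "(\<integral>x. u x * p x \<partial>torus L) = (\<integral>x. f x * w x \<partial>torus L)"
proof -
  have H1: "u \<in> H1 L"
    using u by (simp add: weak_solution_def)
  let ?G = "weak_grad L u"
  have w1: "trig_poly L (partial_deriv i w)" and w2: "trig_poly L (partial_deriv i (partial_deriv i w))"
    for i
    by (intro trig_poly_partial_deriv w)+
  have "(\<integral>x. ?G x \<bullet> weak_grad L w x \<partial>torus L)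
      = (\<integral>x. (\<Sum>i\<in>UNIV. ?G x $ i * partial_deriv i w x) \<partial>torus L)"
  proof (rule integral_cong_AE)
    show "(\<lambda>x. ?G x \<bullet> weak_grad L w x) \<in> borel_measurable (torus L)"
      using integrable_weak_grad_inner[OF H1 trig_poly_H1[OF L w]] by simp
    show "(\<lambda>x. \<Sum>i\<in>UNIV. ?G x $ i * partial_deriv i w x) \<in> borel_measurable (torus L)"
      using integrable_L2_mult[OF weak_grad_L2[OF H1] trig_poly_L2[OF w1]]
      by (intro borel_measurable_sum) simp
    show "AE x in torus L. ?G x \<bullet> weak_grad L w x = (\<Sum>i\<in>UNIV. ?G x $ i * partial_deriv i w x)"
      using weak_grad_trig_poly[OF L w] by eventually_elim (simp add: inner_vec_def)
  qed
  also have "\<dots> = (\<Sum>i\<in>UNIV. \<integral>x. ?G x $ i * partial_deriv i w x \<partial>torus L)"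
    by (intro Bochner_Integration.integral_sum integrable_L2_mult weak_grad_L2 H1 trig_poly_L2 w1)
  \<comment> \<open>\<open>partial_deriv i w\<close> is itself an admissible test function, so the
    definition of the weak gradient puts the second derivative on \<open>w\<close>, and
    \<open>u\<close> needs only first weak derivatives.\<close>
  also have "\<dots> = (\<Sum>i\<in>UNIV. - (\<integral>x. u x * partial_deriv i (partial_deriv i w) x \<partial>torus L))"
    using has_weak_grad_weak_grad[OF H1] trig_poly_test_function[OF L w1]
    by (intro sum.cong) (auto simp: has_weak_grad_def)
  also have "\<dots> = - (\<integral>x. (\<Sum>i\<in>UNIV. u x * partial_deriv i (partial_deriv i w) x) \<partial>torus L)"
    unfolding sum_negf
    by (subst Bochner_Integration.integral_sum)
       (intro integrable_L2_mult H1_L2 H1 trig_poly_L2 w2, simp)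
  finally have grad: "(\<integral>x. ?G x \<bullet> weak_grad L w x \<partial>torus L)
      = - (\<integral>x. (\<Sum>i\<in>UNIV. u x * partial_deriv i (partial_deriv i w) x) \<partial>torus L)" .
  have int1: "integrable (torus L) (\<lambda>x. u x * w x)"
    by (intro integrable_L2_mult H1_L2 H1 trig_poly_L2 w)
  have int2: "integrable (torus L) (\<lambda>x. \<Sum>i\<in>UNIV. u x * partial_deriv i (partial_deriv i w) x)"
    by (intro Bochner_Integration.integrable_sum integrable_L2_mult H1_L2 H1 trig_poly_L2 w2)
  have "a * (\<integral>x. u x * p x \<partial>torus L) = (\<integral>x. u x * (a * p x) \<partial>torus L)"
    by (simp add: mult.left_commute)
  also have "\<dots> = (\<integral>x. a * (u x * w x)
      - (\<Sum>i\<in>UNIV. u x * partial_deriv i (partial_deriv i w) x) \<partial>torus L)"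
    unfolding res[symmetric] by (simp add: algebra_simps sum_distrib_left)
  also have "\<dots> = a * (\<integral>x. u x * w x \<partial>torus L)
      - (\<integral>x. (\<Sum>i\<in>UNIV. u x * partial_deriv i (partial_deriv i w) x) \<partial>torus L)"
    using int1 int2 by simp
  also have "\<dots> = a * (\<integral>x. f x * w x \<partial>torus L)"
    using u trig_poly_H1[OF L w] grad by (auto simp: weak_solution_def)
  finally show ?thesis
    using a by simp
qed

text \<open>The adjoint identity is applied to each solution separately and only the integrals are
  subtracted, so linearity of the weak equation in \<open>u\<close> is never invoked.\<close>

lemma weak_solution_mono:
  fixes f1 f2 u1 u2 :: "real ^ 'n \<Rightarrow> real"
  assumes L: "0 < L" and a: "0 < a" and f: "f1 \<in> L2 L" "f2 \<in> L2 L"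
    and u1: "weak_solution L a f1 u1" and u2: "weak_solution L a f2 u2"
    and le: "AE x in torus L. f1 x \<le> f2 x"
  shows "AE x in torus L. u1 x \<le> u2 x"
proof -
  have uL2: "u1 \<in> L2 L" "u2 \<in> L2 L"
    using u1 u2 by (auto simp: weak_solution_def H1_L2)
  have "AE x in torus L. 0 \<le> u2 x - u1 x"
  proof (rule trig_poly_nonneg_imp_AE_nonneg[OF L L2_diff[OF uL2(2,1)]])
    fix p :: "real ^ 'n \<Rightarrow> real" assume p: "trig_poly L p" and pos: "\<And>x. 0 \<le> p x"
    obtain w where w: "trig_poly L w"
      and res: "\<And>x. a * w x - (\<Sum>i\<in>UNIV. partial_deriv i (partial_deriv i w) x) = a * p x"
      using trig_poly_resolvent[OF a p] by blast
    have w_pos: "0 \<le> w x" for x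
      using a pos by (intro trig_poly_min_principle[OF L a w]) (simp add: res)
    have "AE x in torus L. 0 \<le> (f2 x - f1 x) * w x"
      using le by eventually_elim (simp add: w_pos)
    then have "0 \<le> (\<integral>x. (f2 x - f1 x) * w x \<partial>torus L)"
      by (rule integral_nonneg_AE)
    also have "\<dots> = (\<integral>x. f2 x * w x \<partial>torus L) - (\<integral>x. f1 x * w x \<partial>torus L)"
      using f integrable_L2_mult[OF _ trig_poly_L2[OF w]] by (simp add: left_diff_distrib)
    also have "\<dots> = (\<integral>x. u2 x * p x \<partial>torus L) - (\<integral>x. u1 x * p x \<partial>torus L)"
      using weak_solution_adjoint[OF L a u1 w res] weak_solution_adjoint[OF L a u2 w res] by simp
    also have "\<dots> = (\<integral>x. (u2 x - u1 x) * p x \<partial>torus L)"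
      using uL2 integrable_L2_mult[OF _ trig_poly_L2[OF p]] by (simp add: left_diff_distrib)
    finally show "0 \<le> (\<integral>x. (u2 x - u1 x) * p x \<partial>torus L)" .
  qed
  then show ?thesis
    by simp
qed

section \<open>Constants as test functions and as solutions\<close>

lemma weak_grad_const:
  assumes "0 < L"
  shows "AE x in torus L. weak_grad L (\<lambda>_ :: real ^ 'n. c) x = 0"
proof -
  have "partial_deriv i (\<lambda>_ :: real ^ 'n. c) x = 0" for i x
    by (simp add: partial_deriv_def)
  then show ?thesis
    using weak_grad_trig_poly[OF assms trig_poly_const[of L c, where 'n='n]]
    by (simp add: vec_eq_iff)
qed

lemma integral_weak_grad_const:
  assumes "0 < L"
  shows "(\<integral>x. weak_grad L (\<lambda>_ :: real ^ 'n. c) x \<bullet> G x \<partial>torus L) = 0"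
    and "(\<integral>x. G x \<bullet> weak_grad L (\<lambda>_ :: real ^ 'n. c) x \<partial>torus L) = 0"
proof -
  have "AE x in torus L. weak_grad L (\<lambda>_ :: real ^ 'n. c) x \<bullet> G x = 0"
    using weak_grad_const[OF assms, of c] by eventually_elim simp
  then show "(\<integral>x. weak_grad L (\<lambda>_ :: real ^ 'n. c) x \<bullet> G x \<partial>torus L) = 0"
    by (rule integral_eq_zero_AE)
  then show "(\<integral>x. G x \<bullet> weak_grad L (\<lambda>_ :: real ^ 'n. c) x \<partial>torus L) = 0"
    by (simp add: inner_commute)
qed

text \<open>Constants supply the barriers 0 and 1 for the range bound, and the zero solution against
  which the norm of a single solution is measured.\<close>

lemma weak_solution_const:
  assumes "0 < L"
  shows "weak_solution L a (\<lambda>_ :: real ^ 'n. c) (\<lambda>_. c)"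
  using assms trig_poly_H1[OF assms trig_poly_const]
  by (simp add: weak_solution_def integral_weak_grad_const)

text \<open>Testing with the constant 1 removes the gradient term.\<close>

lemma weak_solution_integral_eq:
  fixes f u :: "real ^ 'n \<Rightarrow> real"
  assumes "0 < L" "a \<noteq> 0" "weak_solution L a f u"
  shows "(\<integral>x. u x \<partial>torus L) = (\<integral>x. f x \<partial>torus L)"
proof -
  have H1: "(\<lambda>_ :: real ^ 'n. 1) \<in> H1 L"
    by (rule trig_poly_H1[OF assms(1) trig_poly_const])
  have "a * (\<integral>x. u x * 1 \<partial>torus L)
      + (\<integral>x. weak_grad L u x \<bullet> weak_grad L (\<lambda>_. 1) x \<partial>torus L) = a * (\<integral>x. f x * 1 \<partial>torus L)"
    by (rule bspec[OF conjunct2[OF assms(3)[unfolded weak_solution_def]] H1])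
  then show ?thesis
    using assms(2) by (simp add: integral_weak_grad_const[OF assms(1)])
qed

section \<open>Quadratic identities, minimality and contraction\<close>

lemma integral_L2_diff_sq:
  fixes f g :: "real ^ 'n \<Rightarrow> real"
  assumes "f \<in> L2 L" "g \<in> L2 L"
  shows "(\<integral>x. (f x - g x)\<^sup>2 \<partial>torus L) = (\<integral>x. f x * f x \<partial>torus L)
    - 2 * (\<integral>x. f x * g x \<partial>torus L) + (\<integral>x. g x * g x \<partial>torus L)"
proof -
  have "(\<integral>x. (f x - g x)\<^sup>2 \<partial>torus L) = (\<integral>x. f x * f x - 2 * (f x * g x) + g x * g x \<partial>torus L)"
    by (intro Bochner_Integration.integral_cong) (auto simp: power2_eq_square algebra_simps)
  then show ?thesis
    using integrable_L2_mult[OF assms(1) assms(1)] integrable_L2_mult[OF assms]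
      integrable_L2_mult[OF assms(2) assms(2)] by simp
qed

text \<open>The two chosen gradients are kept apart throughout, which bypasses the question of how
  the gradient chosen for the difference of \<open>u\<close> and \<open>v\<close> relates to
  them.\<close>

lemma integral_weak_grad_diff_sq:
  fixes u v :: "real ^ 'n \<Rightarrow> real"
  assumes "u \<in> H1 L" "v \<in> H1 L"
  shows "(\<integral>x. (norm (weak_grad L u x - weak_grad L v x))\<^sup>2 \<partial>torus L)
    = (\<integral>x. weak_grad L u x \<bullet> weak_grad L u x \<partial>torus L)
    - 2 * (\<integral>x. weak_grad L u x \<bullet> weak_grad L v x \<partial>torus L)
    + (\<integral>x. weak_grad L v x \<bullet> weak_grad L v x \<partial>torus L)"
proof -
  have "(\<integral>x. (norm (weak_grad L u x - weak_grad L v x))\<^sup>2 \<partial>torus L)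
    = (\<integral>x. weak_grad L u x \<bullet> weak_grad L u x - 2 * (weak_grad L u x \<bullet> weak_grad L v x)
        + weak_grad L v x \<bullet> weak_grad L v x \<partial>torus L)"
    by (intro Bochner_Integration.integral_cong)
       (auto simp: power2_norm_eq_inner inner_diff_left inner_diff_right inner_commute)
  then show ?thesis
    using integrable_weak_grad_inner[OF assms(1) assms(1)] integrable_weak_grad_inner[OF assms]
      integrable_weak_grad_inner[OF assms(2) assms(2)] by simp
qed

text \<open>The functional is quadratic, so its expansion around \<open>u\<close> is exact. The
  linear term is the weak equation tested with \<open>v\<close> minus the same equation tested with
  \<open>u\<close>, hence zero.\<close>

lemma weak_solution_J_functional_diff:
  fixes f u v :: "real ^ 'n \<Rightarrow> real"
  assumes f: "f \<in> L2 L" and u: "weak_solution L a f u" and v: "v \<in> H1 L"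
  shows "J_functional L a f v = J_functional L a f u
    + 1/2 * (\<integral>x. (norm (weak_grad L v x - weak_grad L u x))\<^sup>2 \<partial>torus L)
    + a/2 * (\<integral>x. (v x - u x)\<^sup>2 \<partial>torus L)"
proof -
  have uH1: "u \<in> H1 L"
    using u by (simp add: weak_solution_def)
  have test: "a * (\<integral>x. u x * z x \<partial>torus L) + (\<integral>x. weak_grad L u x \<bullet> weak_grad L z x \<partial>torus L)
      = a * (\<integral>x. f x * z x \<partial>torus L)" if "z \<in> H1 L" for z
    using u that by (simp add: weak_solution_def)
  have J: "J_functional L a f z = 1/2 * (\<integral>x. weak_grad L z x \<bullet> weak_grad L z x \<partial>torus L)
      + a/2 * ((\<integral>x. z x * z x \<partial>torus L) - 2 * (\<integral>x. f x * z x \<partial>torus L) + (\<integral>x. f x * f x \<partial>torus L))"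
    if "z \<in> H1 L" for z
    using integral_L2_diff_sq[OF H1_L2[OF that] f]
    by (simp add: J_functional_def power2_norm_eq_inner mult.commute)
  have comm: "(\<integral>x. weak_grad L v x \<bullet> weak_grad L u x \<partial>torus L) = (\<integral>x. weak_grad L u x \<bullet> weak_grad L v x \<partial>torus L)"
    "(\<integral>x. v x * u x \<partial>torus L) = (\<integral>x. u x * v x \<partial>torus L)"
    by (simp_all add: inner_commute mult.commute)
  show ?thesis
    using test[OF uH1] test[OF v]
    unfolding J[OF uH1] J[OF v] integral_weak_grad_diff_sq[OF v uH1] comm
      integral_L2_diff_sq[OF H1_L2[OF v] H1_L2[OF uH1]]
    by (simp add: field_simps)
qed

lemma weak_solution_unique_minimizer:
  fixes f u :: "real ^ 'n \<Rightarrow> real"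
  assumes a: "0 < a" and f: "f \<in> L2 L" and u: "weak_solution L a f u"
  shows "is_minimizer_H1 L (J_functional L a f) u"
    and "is_minimizer_H1 L (J_functional L a f) v \<Longrightarrow> AE x in torus L. v x = u x"
proof -
  have uH1: "u \<in> H1 L"
    using u by (simp add: weak_solution_def)
  have nonneg: "0 \<le> (\<integral>x. (norm (weak_grad L z x - weak_grad L u x))\<^sup>2 \<partial>torus L)"
    "0 \<le> (\<integral>x. (z x - u x)\<^sup>2 \<partial>torus L)" for z
    by simp_all
  have "J_functional L a f u \<le> J_functional L a f z" if "z \<in> H1 L" for z
    using weak_solution_J_functional_diff[OF f u that] nonneg(1)[of z]
      mult_nonneg_nonneg[OF _ nonneg(2)[of z], of "a/2"] a by linarith
  then show "is_minimizer_H1 L (J_functional L a f) u"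
    using uH1 by (simp add: is_minimizer_H1_def)
  assume v: "is_minimizer_H1 L (J_functional L a f) v"
  then have vH1: "v \<in> H1 L" and "J_functional L a f v \<le> J_functional L a f u"
    using uH1 by (auto simp: is_minimizer_H1_def)
  \<comment> \<open>Both remainder terms are non-negative. Dropping the gradient term leaves the
    zeroth-order one, which forces equality almost everywhere because \<open>a\<close> is
    positive.\<close>
  then have "a/2 * (\<integral>x. (v x - u x)\<^sup>2 \<partial>torus L) \<le> 0"
    using weak_solution_J_functional_diff[OF f u vH1] nonneg(1)[of v] by linarith
  then have "(\<integral>x. (v x - u x)\<^sup>2 \<partial>torus L) = 0"
    using a nonneg(2)[of v] by (simp add: mult_le_0_iff)
  moreover have "integrable (torus L) (\<lambda>x. (v x - u x)\<^sup>2)"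
    using L2_diff[OF H1_L2[OF vH1] H1_L2[OF uH1]] by (simp add: L2_def)
  ultimately have "AE x in torus L. (v x - u x)\<^sup>2 = 0"
    by (subst (asm) integral_nonneg_eq_0_iff_AE) auto
  then show "AE x in torus L. v x = u x"
    by simp
qed

text \<open>The alternating sum of the two equations, each tested with both solutions, is the energy
  identity for the differences \<open>d\<close> and \<open>g\<close>. Dropping its Dirichlet term
  bounds the integral of the square of \<open>d\<close> by that of \<open>g * d\<close>.\<close>

lemma weak_solution_contraction:
  fixes f1 f2 u1 u2 :: "real ^ 'n \<Rightarrow> real"
  assumes a: "0 < a" and f: "f1 \<in> L2 L" "f2 \<in> L2 L"
    and u1: "weak_solution L a f1 u1" and u2: "weak_solution L a f2 u2"
  shows "norm_L2 L (\<lambda>x. u1 x - u2 x) \<le> norm_L2 L (\<lambda>x. f1 x - f2 x)"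
proof -
  have H1: "u1 \<in> H1 L" "u2 \<in> H1 L"
    using u1 u2 by (auto simp: weak_solution_def)
  note uL2 = H1[THEN H1_L2]
  define g d where "g x = f1 x - f2 x" and "d x = u1 x - u2 x" for x
  have gd: "g \<in> L2 L" "d \<in> L2 L"
    unfolding g_def d_def by (intro L2_diff f uL2)+
  have eq: "a * (\<integral>x. (d x)\<^sup>2 \<partial>torus L)
      + (\<integral>x. (norm (weak_grad L u1 x - weak_grad L u2 x))\<^sup>2 \<partial>torus L)
      = a * (\<integral>x. g x * d x \<partial>torus L)"
  proof -
    have "(\<integral>x. g x * d x \<partial>torus L) = (\<integral>x. f1 x * u1 x - f1 x * u2 x - f2 x * u1 x + f2 x * u2 x \<partial>torus L)"
      by (intro Bochner_Integration.integral_cong) (auto simp: g_def d_def algebra_simps)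
    also have "\<dots> = (\<integral>x. f1 x * u1 x \<partial>torus L) - (\<integral>x. f1 x * u2 x \<partial>torus L)
        - (\<integral>x. f2 x * u1 x \<partial>torus L) + (\<integral>x. f2 x * u2 x \<partial>torus L)"
      using integrable_L2_mult[OF f(1) uL2(1)] integrable_L2_mult[OF f(1) uL2(2)]
        integrable_L2_mult[OF f(2) uL2(1)] integrable_L2_mult[OF f(2) uL2(2)] by simp
    finally have rhs: "(\<integral>x. g x * d x \<partial>torus L) = (\<integral>x. f1 x * u1 x \<partial>torus L)
        - (\<integral>x. f1 x * u2 x \<partial>torus L) - (\<integral>x. f2 x * u1 x \<partial>torus L) + (\<integral>x. f2 x * u2 x \<partial>torus L)" .
    have test: "a * (\<integral>x. u x * z x \<partial>torus L) + (\<integral>x. weak_grad L u x \<bullet> weak_grad L z x \<partial>torus L)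
        = a * (\<integral>x. f x * z x \<partial>torus L)" if "weak_solution L a f u" "z \<in> H1 L" for f u z
      using that by (simp add: weak_solution_def)
    have comm: "(\<integral>x. weak_grad L u2 x \<bullet> weak_grad L u1 x \<partial>torus L)
          = (\<integral>x. weak_grad L u1 x \<bullet> weak_grad L u2 x \<partial>torus L)"
      "(\<integral>x. u2 x * u1 x \<partial>torus L) = (\<integral>x. u1 x * u2 x \<partial>torus L)"
      by (simp_all add: inner_commute mult.commute)
    have lhs: "(\<integral>x. (d x)\<^sup>2 \<partial>torus L) = (\<integral>x. u1 x * u1 x \<partial>torus L)
        - 2 * (\<integral>x. u1 x * u2 x \<partial>torus L) + (\<integral>x. u2 x * u2 x \<partial>torus L)"
      unfolding d_def by (rule integral_L2_diff_sq[OF uL2])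
    show ?thesis
      using test[OF u1 H1(1)] test[OF u1 H1(2)] test[OF u2 H1(1)] test[OF u2 H1(2)]
      unfolding rhs lhs integral_weak_grad_diff_sq[OF H1] comm distrib_left right_diff_distrib
      by linarith
  qed
  have "0 \<le> (\<integral>x. (norm (weak_grad L u1 x - weak_grad L u2 x))\<^sup>2 \<partial>torus L)"
    by simp
  then have "a * (\<integral>x. (d x)\<^sup>2 \<partial>torus L) \<le> a * (\<integral>x. g x * d x \<partial>torus L)"
    using eq by linarith
  then have le: "(\<integral>x. (d x)\<^sup>2 \<partial>torus L) \<le> (\<integral>x. g x * d x \<partial>torus L)"
    using a by simp
  \<comment> \<open>This square takes the place of Cauchy--Schwarz and avoids a division by the norm
    of \<open>d\<close>.\<close>
  have "0 \<le> (\<integral>x. (g x - d x)\<^sup>2 \<partial>torus L)"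
    by simp
  then have "2 * (\<integral>x. g x * d x \<partial>torus L) \<le> (\<integral>x. (g x)\<^sup>2 \<partial>torus L) + (\<integral>x. (d x)\<^sup>2 \<partial>torus L)"
    unfolding integral_L2_diff_sq[OF gd] unfolding power2_eq_square by linarith
  then have "(\<integral>x. (d x)\<^sup>2 \<partial>torus L) \<le> (\<integral>x. (g x)\<^sup>2 \<partial>torus L)"
    using le by linarith
  then show ?thesis
    by (simp add: norm_L2_def g_def d_def)
qed

theorem proposition3p4:
  fixes L \<alpha> h a :: real and f u :: "real ^ 'n \<Rightarrow> real"
  assumes "0 < L" and "0 < \<alpha>" and "\<alpha> < 1" and "0 < h"
    and "a = inverse (Gamma (2 - \<alpha>) * h powr \<alpha>)"
    and "f \<in> L2 L" and "weak_solution L a f u"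
  shows
    "(is_minimizer_H1 L (J_functional L a f) u \<and>
      (\<forall>v. is_minimizer_H1 L (J_functional L a f) v \<longrightarrow> (AE x in torus L. v x = u x)))
     \<and> (\<integral>x. u x \<partial>torus L) = (\<integral>x. f x \<partial>torus L)
     \<and> (norm_L2 L u \<le> norm_L2 L f \<and>
        (\<forall>f1\<in>L2 L. \<forall>f2\<in>L2 L. \<forall>u1 u2 :: real ^ 'n \<Rightarrow> real.
           weak_solution L a f1 u1 \<longrightarrow> weak_solution L a f2 u2 \<longrightarrow>
           norm_L2 L (\<lambda>x. u1 x - u2 x) \<le> norm_L2 L (\<lambda>x. f1 x - f2 x)))
     \<and> (((AE x in torus L. 0 \<le> f x \<and> f x \<le> 1) \<longrightarrow> (AE x in torus L. 0 \<le> u x \<and> u x \<le> 1)) \<and>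
        (\<forall>f1\<in>L2 L. \<forall>f2\<in>L2 L. \<forall>u1 u2 :: real ^ 'n \<Rightarrow> real.
           weak_solution L a f1 u1 \<longrightarrow> weak_solution L a f2 u2 \<longrightarrow>
           (AE x in torus L. f1 x \<le> f2 x) \<longrightarrow> (AE x in torus L. u1 x \<le> u2 x)))"
proof -
  note L = assms(1) and f = assms(6) and u = assms(7)
  \<comment> \<open>\<open>2 - \<alpha>\<close> is positive, and Gamma is positive on the positive
    reals.\<close>
  have a: "0 < a"
    using assms(2-5) by (simp add: Gamma_real_pos)
  have const: "(\<lambda>_ :: real ^ 'n. c) \<in> L2 L" for c
    by (intro L2_continuous continuous_on_const)
  have min: "is_minimizer_H1 L (J_functional L a f) u \<and>
      (\<forall>v. is_minimizer_H1 L (J_functional L a f) v \<longrightarrow> (AE x in torus L. v x = u x))"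
    using weak_solution_unique_minimizer[OF a f u] by blast
  have avg: "(\<integral>x. u x \<partial>torus L) = (\<integral>x. f x \<partial>torus L)"
    using a by (intro weak_solution_integral_eq[OF L _ u]) simp
  have norm: "norm_L2 L u \<le> norm_L2 L f"
    using weak_solution_contraction[OF a f const[of 0] u weak_solution_const[OF L]] by simp
  have range: "AE x in torus L. 0 \<le> u x \<and> u x \<le> 1" if "AE x in torus L. 0 \<le> f x \<and> f x \<le> 1"
  proof -
    have "AE x in torus L. 0 \<le> u x"
      using that
      by (intro weak_solution_mono[OF L a const[of 0] f weak_solution_const[OF L] u]) auto
    moreover have "AE x in torus L. u x \<le> 1"
      using that
      by (intro weak_solution_mono[OF L a f const[of 1] u weak_solution_const[OF L]]) auto
    ultimately show ?thesis
      by eventually_elim simp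
  qed
  show ?thesis
    by (intro conjI ballI allI impI min avg norm range)
       (blast intro: weak_solution_contraction[OF a] weak_solution_mono[OF L a])+
qed

end
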